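(* Let $v\in C^{1,1}(\mathbb{R})$ be non-decreasing and non-constant, and for $0<\varepsilon<1$ let $$x_i:=\inf\{x\in\mathbb{R}\,:\,v(x)=\varepsilon i\},\quad i=M_\varepsilon,\ldots,N_\varepsilon,\qquad M_\varepsilon:=\left\lceil\frac{\inf_{\mathbb{R}}v+\varepsilon}{\varepsilon}\right\rceil,\quad N_\varepsilon:=\left\lfloor\frac{\sup_{\mathbb{R}}v-\varepsilon}{\varepsilon}\right\rfloor.$$ Then there exists $c>0$, depending on the $C^{1,1}$ norm of $v$, such that if $\rho\ge c\,\varepsilon^{1/2}$, $\overline{x}\in(x_{M_\varepsilon}+\rho,\,x_{N_\varepsilon}-\rho)$, $x_{i_0}$ is the closest point to $\overline{x}$ among the $x_i$'s, and $\overline{x}=x_{i_0}+\varepsilon\gamma$, then $$\frac1\pi\sum_{i\ne i_0,\ |x_i-\overline{x}|\le\rho}\frac{\varepsilon}{x_i-\overline{x}}=\mathcal{I}_1^{1,\rho}[v](\overline{x})+O(\gamma)+\frac1\pi\,\frac{v(\overline{x}+\rho)+v(\overline{x}-\rho)-2v(\overline{x})}{\rho}+o_\varepsilon(1)$$ and $$\frac1\pi\sum_{i\ne i_0}\frac{\varepsilon}{x_i-\overline{x}}=\mathcal{I}_1[v](\overline{x})+o_\varepsilon(1)+O(\gamma).$$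
   Context: $C^{1,1}(\mathbb{R})$ is the set of functions with bounded $C^{1,1}$ norm over $\mathbb{R}$. Operators: $\mathcal{I}_1[v](x)=\frac1\pi\mathrm{PV}\int_{\mathbb{R}}\frac{v(y)-v(x)}{(y-x)^2}dy$ and, for $r>0$, $\mathcal{I}_1^{1,r}[v](x)=\frac1\pi\mathrm{PV}\int_{|y-x|\le r}\frac{v(y)-v(x)}{(y-x)^2}dy$. Sums run over indices $i\in\{M_\varepsilon,\ldots,N_\varepsilon\}$ satisfying the indicated constraints. Asymptotics are for $\varepsilon\to0$: $o_\varepsilon(1)$ denotes a quantity tending to $0$ as $\varepsilon\to0$ uniformly in $\overline{x}$, and $O(\gamma)$ denotes a quantity bounded in absolute value by $C|\gamma|$ with $C$ independent of $\overline{x}$ and $\varepsilon$. *)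

theory Defs
  imports "HOL-Analysis.Analysis"
begin

definition C11 :: "(real \<Rightarrow> real) \<Rightarrow> bool" where
  "C11 v \<longleftrightarrow> (\<forall>x. v differentiable (at x)) \<and> bounded (range v) \<and>
     bounded (range (deriv v)) \<and> (\<exists>L. L-lipschitz_on UNIV (deriv v))"

(* Only meaningful for functions satisfying C11, where all three suprema are finite. *)
definition C11_norm :: "(real \<Rightarrow> real) \<Rightarrow> real" where
  "C11_norm v = (SUP x. \<bar>v x\<bar>) + (SUP x. \<bar>deriv v x\<bar>) +
     (SUP (x, y) \<in> {(x, y). x \<noteq> y}. \<bar>deriv v x - deriv v y\<bar> / \<bar>x - y\<bar>)"

(* Principal value at the singularity x. No truncation at infinity is needed: the integrands
   used below are absolutely integrable away from x when v is bounded and continuous, and the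
   limit exists when C11 v holds. Where the limit does not exist, Lim is unspecified. *)
definition pv_integral :: "real set \<Rightarrow> real \<Rightarrow> (real \<Rightarrow> real) \<Rightarrow> real" where
  "pv_integral A x f = Lim (at_right 0) (\<lambda>\<delta>. LINT y:{y \<in> A. \<delta> < \<bar>y - x\<bar>}|lborel. f y)"

definition I1 :: "(real \<Rightarrow> real) \<Rightarrow> real \<Rightarrow> real" where
  "I1 v x = 1 / pi * pv_integral UNIV x (\<lambda>y. (v y - v x) / (y - x)\<^sup>2)"

definition I1_short :: "real \<Rightarrow> (real \<Rightarrow> real) \<Rightarrow> real \<Rightarrow> real" where
  "I1_short r v x = 1 / pi * pv_integral {y. \<bar>y - x\<bar> \<le> r} x (\<lambda>y. (v y - v x) / (y - x)\<^sup>2)"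

definition M_idx :: "(real \<Rightarrow> real) \<Rightarrow> real \<Rightarrow> int" where
  "M_idx v \<epsilon> = \<lceil>((INF x. v x) + \<epsilon>) / \<epsilon>\<rceil>"

definition N_idx :: "(real \<Rightarrow> real) \<Rightarrow> real \<Rightarrow> int" where
  "N_idx v \<epsilon> = \<lfloor>((SUP x. v x) - \<epsilon>) / \<epsilon>\<rfloor>"

(* For v continuous and bounded and M_idx v \<epsilon> \<le> i \<le> N_idx v \<epsilon>, the value \<epsilon> * i lies strictly
   between inf v and sup v; for monotone v the level set is then nonempty and bounded,
   so Inf is the genuine infimum. *)
definition level_pt :: "(real \<Rightarrow> real) \<Rightarrow> real \<Rightarrow> int \<Rightarrow> real" where
  "level_pt v \<epsilon> i = Inf {x. v x = \<epsilon> * of_int i}"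

definition closest_idx :: "(real \<Rightarrow> real) \<Rightarrow> real \<Rightarrow> real \<Rightarrow> int \<Rightarrow> bool" where
  "closest_idx v \<epsilon> z i0 \<longleftrightarrow> i0 \<in> {M_idx v \<epsilon>..N_idx v \<epsilon>} \<and>
     (\<forall>i \<in> {M_idx v \<epsilon>..N_idx v \<epsilon>}. \<bar>level_pt v \<epsilon> i0 - z\<bar> \<le> \<bar>level_pt v \<epsilon> i - z\<bar>)"

end

theory Submission
  imports Defs
begin

text \<open>The measure that puts mass \<open>\<epsilon>\<close> at every level point \<open>x\<^sub>i\<close> approximates the measure with density the
  derivative of \<open>v\<close>, because the number of level points in an interval, times \<open>\<epsilon>\<close>, is the increment of \<open>v\<close>
  up to \<open>O(\<epsilon>)\<close> (\<open>level_count\<close>). Hence the sum of \<open>\<epsilon> / (x\<^sub>i - z)\<close> should be the principal value of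
  \<open>v'(y) / (y - z)\<close>, and integration by parts turns this into the half-Laplacian plus a boundary term at the
  truncation radius. The problem is the singularity at \<open>z\<close>, where counting alone is too crude.

  The cutoff radius is \<open>r = sqrt \<epsilon>\<close>. Outside the window \<open>\<bar>x\<^sub>i - z\<bar> \<le> r\<close>, summation by parts against the
  counting function costs only \<open>O(\<epsilon> / r) = O(r)\<close> (\<open>reciprocal_sum_approx\<close>, \<open>outer_sum\<close>). The continuous
  counterpart of the window is \<open>O(r)\<close> because the second differences of \<open>v\<close> are quadratically small. It
  remains to see that the sum inside the window is itself \<open>o(1) + O(\<gamma>)\<close> (\<open>inner_sum\<close>). First the pole is moved
  from \<open>z\<close> to the nearest level point; this costs \<open>O(\<gamma>)\<close> (\<open>recentre_sum\<close>). Then \<open>v\<close> is replaced by its tangent,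
  and the sum becomes \<open>p\<close> times a sum of reciprocals \<open>1 / k\<close> of nonzero integers, where \<open>p\<close> is the slope
  (\<open>linearised_sum\<close>). Finally these cancel in pairs: by counting again, the numbers of positive and negative \<open>k\<close>
  differ by \<open>O(1)\<close>, and when \<open>p\<close> is not small the window holds many points on both sides, so each unpaired term
  contributes only \<open>O(r)\<close> (\<open>balanced_window\<close>).

  All errors are independent of the truncation radius \<open>R \<ge> r\<close>. Taking \<open>R = \<rho>\<close> gives the formula for the
  truncated operator (\<open>truncated_sum\<close>), and letting \<open>R\<close> tend to infinity the one for the full operator
  (\<open>full_sum\<close>). In particular \<open>c = 1\<close> works in \<open>\<rho> \<ge> c * sqrt \<epsilon>\<close>.\<close>

section \<open>Counting integers and summing reciprocals\<close>

lemma card_int_open_ge: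
  fixes \<alpha> \<beta> :: real
  shows "\<beta> - \<alpha> - 1 \<le> card {k::int. \<alpha> < k \<and> k < \<beta>}"
proof -
  have "{k::int. \<alpha> < k \<and> k < \<beta>} = {\<lfloor>\<alpha>\<rfloor> + 1..\<lceil>\<beta>\<rceil> - 1}"
    by (auto simp: floor_less_iff less_ceiling_iff) linarith+
  then show ?thesis by simp linarith
qed

lemma card_int_closed_le:
  fixes \<alpha> \<beta> :: real
  assumes "\<alpha> \<le> \<beta>"
  shows "card {k::int. \<alpha> \<le> k \<and> k \<le> \<beta>} \<le> \<beta> - \<alpha> + 1"
proof -
  have "{k::int. \<alpha> \<le> k \<and> k \<le> \<beta>} = {\<lceil>\<alpha>\<rceil>..\<lfloor>\<beta>\<rfloor>}"
    by (auto simp: ceiling_le_iff le_floor_iff)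
  then show ?thesis using assms by simp linarith
qed

lemma finite_int_closed: "finite {k::int. (\<alpha>::real) \<le> k \<and> k \<le> \<beta>}"
proof -
  have "{k::int. \<alpha> \<le> k \<and> k \<le> \<beta>} = {\<lceil>\<alpha>\<rceil>..\<lfloor>\<beta>\<rfloor>}"
    by (auto simp: ceiling_le_iff le_floor_iff)
  then show ?thesis by simp
qed

lemma sum_symmetric_int:
  fixes g :: "int \<Rightarrow> real"
  assumes "\<And>k. g (- k) = g k"
  shows "(\<Sum>k\<in>{- int n..int n} - {0}. g k) = 2 * (\<Sum>k=1..n. g (int k))"
proof (induction n)
  case 0
  then show ?case by simp
next
  case (Suc n)
  have "{- int (Suc n)..int (Suc n)} - {0} =
      insert (int (Suc n)) (insert (- int (Suc n)) ({- int n..int n} - {0}))"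
    by auto
  then show ?case using Suc assms[of "int (Suc n)"] by simp
qed

lemma sum_inverse_squares_le: "(\<Sum>k=1..n. 1 / (real k)\<^sup>2) \<le> 2"
proof -
  have "(\<Sum>k=1..n. 1 / (real k)\<^sup>2) \<le> 2 - 1 / real n"
  proof (induction n)
    case (Suc n)
    show ?case
    proof (cases "n = 0")
      case False
      have "1 / (real n + 1)\<^sup>2 \<le> 1 / real n - 1 / (real n + 1)"
      proof -
        have "1 / (real n + 1)\<^sup>2 \<le> 1 / (real n * (real n + 1))"
          using False by (intro divide_left_mono) (auto simp: power2_eq_square)
        also have "\<dots> = 1 / real n - 1 / (real n + 1)" using False by (simp add: field_simps)
        finally show ?thesis .
      qed
      then show ?thesis using Suc by (simp add: add.commute)
    qed simp
  qed simp
  then show ?thesis by (smt (verit) divide_nonneg_nonneg of_nat_0_le_iff)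
qed

text \<open>The true order is logarithmic. Any bound of lower order than \<open>n\<close> is enough below, where \<open>n\<close> is of
  order \<open>1 / r\<close> and the sum is multiplied by \<open>r\<close>; a square root telescopes most easily.\<close>

lemma sum_reciprocals_le_sqrt: "(\<Sum>k=1..n. 1 / real k) \<le> 2 * sqrt n"
proof (induction n)
  case (Suc n)
  have "sqrt n * sqrt (Suc n) \<le> n + 1/2"
  proof -
    have "sqrt n * sqrt (Suc n) = sqrt (n * Suc n)" by (simp only: real_sqrt_mult of_nat_mult)
    also have "\<dots> \<le> n + 1/2" by (rule real_le_lsqrt) (auto simp: power2_eq_square field_simps)
    finally show ?thesis .
  qed
  then have "1 \<le> 2 * (sqrt (Suc n) - sqrt n) * sqrt (Suc n)"
    by (simp add: algebra_simps)
  then have "1 / sqrt (Suc n) \<le> 2 * (sqrt (Suc n) - sqrt n)"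
    by (simp add: divide_le_eq)
  moreover have "1 / Suc n \<le> 1 / sqrt (Suc n)"
    by (rule divide_left_mono) (auto simp: real_le_lsqrt power2_eq_square)
  ultimately show ?case using Suc by simp
qed simp

text \<open>The two partial sums differ by \<open>\<bar>b - a\<bar>\<close> terms, none of which exceeds the first one beyond the
  shorter sum.\<close>

lemma harmonic_diff_le:
  fixes a b :: nat
  shows "\<bar>(\<Sum>k=1..b. 1 / real k) - (\<Sum>k=1..a. 1 / real k)\<bar> \<le> \<bar>real b - real a\<bar> / (min (real a) (real b) + 1)"
proof -
  have *: "0 \<le> (\<Sum>k=1..b. 1 / real k) - (\<Sum>k=1..a. 1 / real k) \<and>
     (\<Sum>k=1..b. 1 / real k) - (\<Sum>k=1..a. 1 / real k) \<le> (real b - real a) / (real a + 1)"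
    if "a \<le> b" for a b :: nat
  proof -
    have "{1..b} = {1..a} \<union> {Suc a..b}" using that by auto
    then have "(\<Sum>k=1..b. 1 / real k) = (\<Sum>k=1..a. 1 / real k) + (\<Sum>k=Suc a..b. 1 / real k)"
      by (simp add: sum.union_disjoint)
    moreover have "(\<Sum>k=Suc a..b. 1 / real k) \<le> (\<Sum>k=Suc a..b. 1 / (real a + 1))"
      by (rule sum_mono) (auto intro!: divide_left_mono)
    moreover have "0 \<le> (\<Sum>k=Suc a..b. 1 / real k)" by (rule sum_nonneg) auto
    ultimately show ?thesis using that by (simp add: of_nat_diff)
  qed
  show ?thesis
    using *[of a b] *[of b a] by (cases "a \<le> b") (auto simp: min_def abs_if)
qed

lemma initial_segment_eq:
  fixes T :: "int set"
  assumes fin: "finite T" and pos: "\<And>i. i \<in> T \<Longrightarrow> 0 < i" and down: "\<And>i j. i \<in> T \<Longrightarrow> 0 < j \<Longrightarrow> j \<le> i \<Longrightarrow> j \<in> T"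
  shows "T = int ` {1..card T}"
proof (cases "T = {}")
  case False
  have "T = {1..Max T}"
  proof
    show "T \<subseteq> {1..Max T}" using pos fin by force
    show "{1..Max T} \<subseteq> T" using down[OF Max_in[OF fin False]] by auto
  qed
  moreover have "1 \<le> Max T" using pos[OF Max_in[OF fin False]] by simp
  ultimately have "int (card T) = Max T" by (metis card_atLeastAtMost_int diff_add_cancel int_nat_eq zero_le_one order_trans)
  then have "T = {1..int (card T)}" using \<open>T = {1..Max T}\<close> by simp
  also have "\<dots> = int ` {1..card T}" by (simp add: image_int_atLeastAtMost)
  finally show ?thesis .
qed simp

lemma sum_initial_segment:
  fixes T :: "int set" and g :: "int \<Rightarrow> real"
  assumes "finite T" and "\<And>i. i \<in> T \<Longrightarrow> 0 < i" and "\<And>i j. i \<in> T \<Longrightarrow> 0 < j \<Longrightarrow> j \<le> i \<Longrightarrow> j \<in> T"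
  shows "sum g T = (\<Sum>k=1..card T. g (int k))"
proof -
  have "sum g T = sum g (int ` {1..card T})"
    using initial_segment_eq[OF assms] by (rule arg_cong)
  also have "\<dots> = (\<Sum>k=1..card T. g (int k))" by (subst sum.reindex) auto
  finally show ?thesis .
qed

text \<open>Over a block of consecutive integers, the reciprocals of the signed distances to \<open>i0\<close> cancel in pairs; what
  remains comes from the imbalance between the numbers \<open>a\<close> and \<open>b\<close> of indices on the two sides.\<close>

lemma reciprocal_sum_int_interval:
  fixes S :: "int set"
  assumes fin: "finite S"
    and up: "\<And>i j. i \<in> S \<Longrightarrow> i0 < j \<Longrightarrow> j \<le> i \<Longrightarrow> j \<in> S"
    and down: "\<And>i j. i \<in> S \<Longrightarrow> j < i0 \<Longrightarrow> i \<le> j \<Longrightarrow> j \<in> S"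
  defines "a \<equiv> real (card {i\<in>S. i < i0})" and "b \<equiv> real (card {i\<in>S. i0 < i})"
  shows "\<bar>\<Sum>i\<in>S - {i0}. 1 / real_of_int (i - i0)\<bar> \<le> \<bar>b - a\<bar> / (min a b + 1)"
proof -
  define P Q where "P = (\<lambda>i. i - i0) ` {i\<in>S. i0 < i}" and "Q = (\<lambda>i. i0 - i) ` {i\<in>S. i < i0}"
  have card: "card P = card {i\<in>S. i0 < i}" "card Q = card {i\<in>S. i < i0}"
    unfolding P_def Q_def by (intro card_image; auto simp: inj_on_def)+
  have P: "(\<Sum>k\<in>P. 1 / real_of_int k) = (\<Sum>k=1..card P. 1 / real_of_int (int k))"
  proof (rule sum_initial_segment)
    fix i j assume "i \<in> P" "0 < j" "j \<le> i"
    then have "i + i0 \<in> S" by (auto simp: P_def)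
    then have "j + i0 \<in> S" using up[of "i + i0" "j + i0"] \<open>0 < j\<close> \<open>j \<le> i\<close> by simp
    then show "j \<in> P" using \<open>0 < j\<close> by (auto simp: P_def intro!: image_eqI[of _ _ "j + i0"])
  qed (use fin in \<open>auto simp: P_def\<close>)
  have Q: "(\<Sum>k\<in>Q. 1 / real_of_int k) = (\<Sum>k=1..card Q. 1 / real_of_int (int k))"
  proof (rule sum_initial_segment)
    fix i j assume "i \<in> Q" "0 < j" "j \<le> i"
    then have "i0 - i \<in> S" by (auto simp: Q_def)
    then have "i0 - j \<in> S" using down[of "i0 - i" "i0 - j"] \<open>0 < j\<close> \<open>j \<le> i\<close> by simp
    then show "j \<in> Q" using \<open>0 < j\<close> by (auto simp: Q_def intro!: image_eqI[of _ _ "i0 - j"])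
  qed (use fin in \<open>auto simp: Q_def\<close>)
  have split: "S - {i0} = {i\<in>S. i0 < i} \<union> {i\<in>S. i < i0}" by auto
  have "(\<Sum>i\<in>S - {i0}. 1 / real_of_int (i - i0))
      = (\<Sum>i | i \<in> S \<and> i0 < i. 1 / real_of_int (i - i0)) + (\<Sum>i | i \<in> S \<and> i < i0. 1 / real_of_int (i - i0))"
    unfolding split using fin by (intro sum.union_disjoint) auto
  also have "(\<Sum>i | i \<in> S \<and> i0 < i. 1 / real_of_int (i - i0)) = (\<Sum>k\<in>P. 1 / real_of_int k)"
    unfolding P_def by (subst sum.reindex) (auto simp: inj_on_def)
  also have "(\<Sum>i | i \<in> S \<and> i < i0. 1 / real_of_int (i - i0)) = - (\<Sum>k\<in>Q. 1 / real_of_int k)"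
  proof -
    have neg: "1 / real_of_int (i - i0) = - (1 / real_of_int (i0 - i))" for i
      using minus_divide_right[of 1 "real_of_int (i0 - i)"] by simp
    show ?thesis unfolding Q_def neg sum_negf by (subst sum.reindex) (auto simp: inj_on_def)
  qed
  finally show ?thesis
    using harmonic_diff_le[of "card P" "card Q"] by (simp add: P Q card a_def b_def)
qed

section \<open>Summation by parts\<close>

text \<open>Summation by parts, as an integral. Since \<open>1 / t = 1 / R + \<integral> 1 / s\<^sup>2 ds\<close> over \<open>[t, R]\<close>, the sum is a linear
  functional of its counting function \<open>s \<mapsto> card {i. t i \<le> s}\<close>, and the main term is the same functional
  applied to \<open>G\<close>. So a uniform error in the counting function is multiplied by at most
  \<open>1 / R + \<integral> 1 / s\<^sup>2 ds = 1 / r\<close>. The main term is \<open>\<integral> G'(s) / s ds\<close> integrated by parts, and it does not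
  change when a constant is added to \<open>G\<close>.\<close>

lemma reciprocal_sum_approx:
  fixes t :: "'i \<Rightarrow> real" and G :: "real \<Rightarrow> real" and e :: real
  assumes S: "finite S" "\<And>i. i \<in> S \<Longrightarrow> r < t i" "\<And>i. i \<in> S \<Longrightarrow> t i \<le> R"
    and r: "0 < r" "r \<le> R" and G: "continuous_on {r..R} G"
    and count: "\<And>s. s \<in> {r..R} \<Longrightarrow> \<bar>e * card {i\<in>S. t i \<le> s} - (G s - G r)\<bar> \<le> E"
  shows "\<bar>(\<Sum>i\<in>S. e / t i) - (G R / R - G r / r + integral {r..R} (\<lambda>s. G s / s\<^sup>2))\<bar> \<le> E / r"
proof -
  have tail: "((\<lambda>s. 1 / s\<^sup>2) has_integral (1 / a - 1 / R)) {a..R}" if "0 < a" "a \<le> R" for a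
  proof -
    have "((\<lambda>s. 1 / s\<^sup>2) has_integral (- 1 / R - - 1 / a)) {a..R}"
      using that by (intro fundamental_theorem_of_calculus)
        (auto intro!: derivative_eq_intros simp flip: has_real_derivative_iff_has_vector_derivative
          simp: power2_eq_square)
    then show ?thesis by simp
  qed
  \<comment> \<open>the sum as the functional of its counting function \<open>N\<close>\<close>
  define N where "N s = real (card {i\<in>S. t i \<le> s})" for s
  have N: "N s = (\<Sum>i\<in>S. if t i \<le> s then 1 else 0)" for s
    using S(1) by (simp add: N_def sum.If_cases Int_def)
  have "((\<lambda>s. if s \<in> {t i..R} then 1 / s\<^sup>2 else 0) has_integral (1 / t i - 1 / R)) {r..R}"
    if "i \<in> S" for i
    using tail[of "t i"] S(2,3)[OF that] r
    by (subst has_integral_restrict) auto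
  then have "((\<lambda>s. \<Sum>i\<in>S. if s \<in> {t i..R} then 1 / s\<^sup>2 else 0) has_integral
      (\<Sum>i\<in>S. 1 / t i - 1 / R)) {r..R}"
    by (rule has_integral_sum[OF S(1)])
  moreover have "(\<Sum>i\<in>S. if s \<in> {t i..R} then 1 / s\<^sup>2 else 0) = N s / s\<^sup>2" if "s \<in> {r..R}" for s
    unfolding N sum_divide_distrib using that by (intro sum.cong) auto
  ultimately have "((\<lambda>s. N s / s\<^sup>2) has_integral (\<Sum>i\<in>S. 1 / t i - 1 / R)) {r..R}"
    by (rule has_integral_eq[rotated]) auto
  then have "((\<lambda>s. e * (N s / s\<^sup>2)) has_integral e * (\<Sum>i\<in>S. 1 / t i - 1 / R)) {r..R}"
    by (rule has_integral_mult_right)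
  moreover have "((\<lambda>s. G s / s\<^sup>2) has_integral integral {r..R} (\<lambda>s. G s / s\<^sup>2)) {r..R}"
    using r by (intro integrable_integral integrable_continuous_interval continuous_intros G) auto
  moreover have "((\<lambda>s. G r * (1 / s\<^sup>2)) has_integral G r * (1 / r - 1 / R)) {r..R}"
    by (intro has_integral_mult_right tail r)
  ultimately have dev: "((\<lambda>s. e * (N s / s\<^sup>2) - (G s / s\<^sup>2 - G r * (1 / s\<^sup>2))) has_integral
     e * (\<Sum>i\<in>S. 1 / t i - 1 / R) - (integral {r..R} (\<lambda>s. G s / s\<^sup>2) - G r * (1 / r - 1 / R))) {r..R}"
    (is "(?d has_integral ?X) _")
    by (intro has_integral_diff)
  have dom: "((\<lambda>s. E * (1 / s\<^sup>2)) has_integral E * (1 / r - 1 / R)) {r..R}"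
    by (intro has_integral_mult_right tail r)
  have le: "norm (?d s) \<le> E * (1 / s\<^sup>2)" if "s \<in> {r..R}" for s
  proof -
    have "?d s = (e * N s - (G s - G r)) / s\<^sup>2" by (simp add: diff_divide_distrib)
    then show ?thesis using count[OF that] by (simp add: N_def abs_divide divide_right_mono)
  qed
  have "norm (integral {r..R} ?d) \<le> integral {r..R} (\<lambda>s. E * (1 / s\<^sup>2))"
    using dev dom le by (intro Henstock_Kurzweil_Integration.integral_norm_bound_integral) auto
  then have "\<bar>?X\<bar> \<le> E * (1 / r - 1 / R)"
    unfolding integral_unique[OF dev] integral_unique[OF dom] by simp
  moreover have "\<bar>(e * card S - (G R - G r)) / R\<bar> \<le> E / R"
  proof -
    have "{i\<in>S. t i \<le> R} = S" using S(3) by auto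
    then show ?thesis using count[of R] r by (simp add: abs_divide divide_right_mono)
  qed
  moreover have "(\<Sum>i\<in>S. e / t i) - (G R / R - G r / r + integral {r..R} (\<lambda>s. G s / s\<^sup>2))
     = ?X + (e * card S - (G R - G r)) / R"
    by (simp add: sum_subtractf sum_distrib_left right_diff_distrib diff_divide_distrib add_divide_distrib)
  moreover have "E * (1 / r - 1 / R) + E / R = E / r" by (simp add: right_diff_distrib)
  ultimately show ?thesis by linarith
qed

section \<open>The principal value as an integral of second differences\<close>

text \<open>Pairing \<open>z + t\<close> with \<open>z - t\<close> removes the singularity: the principal value becomes an absolutely
  convergent integral over \<open>t > 0\<close>.\<close>

abbreviation second_diff :: "(real \<Rightarrow> real) \<Rightarrow> real \<Rightarrow> real \<Rightarrow> real" where
  "second_diff v z t \<equiv> v (z + t) + v (z - t) - 2 * v z"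

text \<open>The constants are kept as separate parameters, because the estimates use the size of \<open>v\<close>, of its slope
  and of its Lipschitz constant at different places.\<close>

locale bounded_C11 =
  fixes v v' :: "real \<Rightarrow> real" and L B V :: real
  assumes has_deriv: "\<And>x. (v has_real_derivative v' x) (at x)"
    and lip: "\<And>x y. \<bar>v' x - v' y\<bar> \<le> L * \<bar>x - y\<bar>"
    and slope_bound: "\<And>x. \<bar>v' x\<bar> \<le> V"
    and bound: "\<And>x. \<bar>v x\<bar> \<le> B"
begin

lemma L_nonneg: "0 \<le> L"
  using lip[of 1 0] by (smt (verit) abs_ge_zero mult_cancel_left1)

lemma V_nonneg: "0 \<le> V"
  using slope_bound[of 0] by linarith

lemma continuous: "continuous_on A v"
  using has_deriv by (meson DERIV_isCont continuous_at_imp_continuous_on)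

lemma measurable_v [measurable]: "v \<in> borel_measurable borel"
  using continuous by (rule borel_measurable_continuous_onI)

lemma mean_value:
  assumes "a < b"
  obtains \<xi> where "a < \<xi>" "\<xi> < b" "v b - v a = (b - a) * v' \<xi>"
  using MVT2[OF assms has_deriv] by blast

lemma taylor: "\<bar>v y - v x - v' x * (y - x)\<bar> \<le> L * (y - x)\<^sup>2"
proof -
  have "\<exists>\<xi>. \<bar>\<xi> - x\<bar> \<le> \<bar>y - x\<bar> \<and> v y - v x = (y - x) * v' \<xi>"
  proof (cases x y rule: linorder_cases)
    case less
    then show ?thesis by (rule mean_value) (auto intro!: exI)
  next
    case greater
    then obtain \<xi> where "y < \<xi>" "\<xi> < x" "v x - v y = (x - y) * v' \<xi>" by (rule mean_value)
    then show ?thesis by (intro exI[of _ \<xi>]) (auto simp: algebra_simps)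
  qed auto
  then obtain \<xi> where \<xi>: "\<bar>\<xi> - x\<bar> \<le> \<bar>y - x\<bar>" "v y - v x = (y - x) * v' \<xi>" by blast
  have "\<bar>v y - v x - v' x * (y - x)\<bar> = \<bar>y - x\<bar> * \<bar>v' \<xi> - v' x\<bar>"
    by (simp add: \<xi>(2) flip: abs_mult) (simp add: algebra_simps)
  also have "\<dots> \<le> \<bar>y - x\<bar> * (L * \<bar>y - x\<bar>)"
    using lip[of \<xi> x] \<xi>(1) L_nonneg
    by (intro mult_left_mono) (auto intro: order_trans mult_left_mono)
  also have "\<dots> = L * (y - x)\<^sup>2" by (simp add: power2_eq_square)
  finally show ?thesis .
qed

lemma second_diff_le: "\<bar>second_diff v z t\<bar> \<le> 2 * L * t\<^sup>2"
  using taylor[of "z + t" z] taylor[of "z - t" z] by (simp add: algebra_simps)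

lemma second_diff_bounded: "\<bar>second_diff v z t\<bar> \<le> 4 * B"
  using bound[of "z + t"] bound[of "z - t"] bound[of z] by linarith

lemma second_quotient_le: "\<bar>second_diff v z t / t\<^sup>2\<bar> \<le> 2 * L"
  using second_diff_le[of z t] L_nonneg by (cases "t = 0") (simp_all add: abs_divide divide_le_eq)

lemma inverse_square_integrable:
  fixes \<delta> :: real
  assumes "0 < \<delta>"
  shows "set_integrable lborel {\<delta><..} (\<lambda>t. 1 / t\<^sup>2)"
proof -
  have "(\<lambda>t::real. 1 / t\<^sup>2) absolutely_integrable_on {\<delta>..}"
    using has_integral_inverse_power_to_inf[of 2 \<delta>] assms
    by (intro nonnegative_absolutely_integrable_1) (auto simp: has_integral_integrable)
  then have "integrable lborel (\<lambda>t::real. indicator {\<delta>..} t *\<^sub>R (1 / t\<^sup>2))"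
    unfolding set_integrable_def by (subst (asm) integrable_completion) auto
  then have "set_integrable lborel {\<delta>..} (\<lambda>t. 1 / t\<^sup>2)" unfolding set_integrable_def .
  then show ?thesis by (rule set_integrable_subset) auto
qed

text \<open>A bounded numerator is harmless at infinity, and the set stays away from the singularity.\<close>

lemma kernel_integrable:
  fixes \<delta> :: real
  assumes "0 < \<delta>" and W: "W \<in> sets borel" "W \<subseteq> {\<delta><..}"
    and g: "g \<in> borel_measurable borel" "\<And>t. \<bar>g t\<bar> \<le> K"
  shows "set_integrable lborel W (\<lambda>t. g t / t\<^sup>2)"
proof -
  have "set_integrable lborel W (\<lambda>t. K * (1 / t\<^sup>2))"
    using set_integrable_subset[OF inverse_square_integrable[OF assms(1)]] W
    by (intro set_integrable_mult_right) auto
  then show ?thesis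
  proof (rule set_integrable_bound)
    show "set_borel_measurable lborel W (\<lambda>t. g t / t\<^sup>2)"
      unfolding set_borel_measurable_def using W(1) g(1) by measurable
    show "AE t in lborel. t \<in> W \<longrightarrow> norm (g t / t\<^sup>2) \<le> norm (K * (1 / t\<^sup>2))"
      using g(2) by (auto simp: abs_divide abs_mult intro!: divide_right_mono order_trans[OF _ abs_ge_self])
  qed
qed

lemma punctured_integral:
  assumes "0 < \<delta>" and W: "W \<in> sets borel" "W \<subseteq> {\<delta><..}"
  shows "(LINT y:{y. \<bar>y - z\<bar> \<in> W}|lborel. (v y - v z) / (y - z)\<^sup>2)
      = (LINT t:W|lborel. second_diff v z t / t\<^sup>2)"
proof -
  define f where "f y = (v y - v z) / (y - z)\<^sup>2" for y
  define P Q where "P = {y. y - z \<in> W}" and "Q = {y. z - y \<in> W}"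
  have bd: "\<bar>v a - v b\<bar> \<le> 2 * B" for a b using bound[of a] bound[of b] by linarith
  have [measurable]: "W \<in> sets borel" by fact
  have meas [measurable]: "P \<in> sets lborel" "Q \<in> sets lborel" unfolding P_def Q_def by measurable
  have gp: "set_integrable lborel W (\<lambda>t. (v (z + t) - v z) / t\<^sup>2)"
    and gm: "set_integrable lborel W (\<lambda>t. (v (z - t) - v z) / t\<^sup>2)"
    by (rule kernel_integrable[OF assms, where K = "2 * B"]; use bd in auto)+
  have shift: "indicator P (z + 1 * t) *\<^sub>R f (z + 1 * t) = indicator W t *\<^sub>R ((v (z + t) - v z) / t\<^sup>2)"
    and flip: "indicator Q (z + (- 1) * t) *\<^sub>R f (z + (- 1) * t) = indicator W t *\<^sub>R ((v (z - t) - v z) / t\<^sup>2)" for t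
    by (auto simp: P_def Q_def f_def indicator_def)
  have intP: "set_integrable lborel P f"
    using lborel_integrable_real_affine_iff[of 1 "\<lambda>y. indicator P y *\<^sub>R f y" z] gp
    unfolding set_integrable_def shift by simp
  have intQ: "set_integrable lborel Q f"
    using lborel_integrable_real_affine_iff[of "- 1" "\<lambda>y. indicator Q y *\<^sub>R f y" z] gm
    unfolding set_integrable_def flip by simp
  have pos: "0 < t" if "t \<in> W" for t using that W(2) \<open>0 < \<delta>\<close> by force
  have "{y. \<bar>y - z\<bar> \<in> W} = P \<union> Q"
    using pos[of "y - z" for y] pos[of "z - y" for y] by (force simp: P_def Q_def abs_if)
  moreover have "P \<inter> Q = {}"
  proof -
    have False if "y \<in> P" "y \<in> Q" for y
      using that pos[of "y - z"] pos[of "z - y"] by (auto simp: P_def Q_def)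
    then show ?thesis by blast
  qed
  ultimately have "(LINT y:{y. \<bar>y - z\<bar> \<in> W}|lborel. f y) = (LINT y:P|lborel. f y) + (LINT y:Q|lborel. f y)"
    using intP intQ by (simp add: set_integral_Un)
  also have "(LINT y:P|lborel. f y) = (LINT t:W|lborel. (v (z + t) - v z) / t\<^sup>2)"
    using lborel_integral_real_affine[of 1 "\<lambda>y. indicator P y *\<^sub>R f y" z]
    unfolding set_lebesgue_integral_def shift by simp
  also have "(LINT y:Q|lborel. f y) = (LINT t:W|lborel. (v (z - t) - v z) / t\<^sup>2)"
    using lborel_integral_real_affine[of "- 1" "\<lambda>y. indicator Q y *\<^sub>R f y" z]
    unfolding set_lebesgue_integral_def flip by simp
  also have "(LINT t:W|lborel. (v (z + t) - v z) / t\<^sup>2) + (LINT t:W|lborel. (v (z - t) - v z) / t\<^sup>2)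
      = (LINT t:W|lborel. (v (z + t) - v z) / t\<^sup>2 + (v (z - t) - v z) / t\<^sup>2)"
    using gp gm by simp
  also have "\<dots> = (LINT t:W|lborel. second_diff v z t / t\<^sup>2)"
    by (simp add: add_divide_distrib[symmetric] algebra_simps)
  finally show ?thesis by (simp add: f_def)
qed

text \<open>Near the singularity the integrand is bounded by \<open>2 * L\<close>, so the piece up to \<open>\<delta>\<close> is of order \<open>\<delta>\<close>. This
  gives integrability at \<open>0\<close> and the convergence of the principal value.\<close>

lemma second_quotient_near:
  assumes W: "W \<in> sets borel" "W \<subseteq> {0<..\<delta>}" and "0 \<le> \<delta>"
  shows "set_integrable lborel W (\<lambda>t. second_diff v z t / t\<^sup>2)"
    and "\<bar>LINT t:W|lborel. second_diff v z t / t\<^sup>2\<bar> \<le> 2 * L * \<delta>"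
proof -
  have fin: "set_integrable lborel {0<..\<delta>} (\<lambda>t. 2 * L)"
    unfolding set_integrable_def by (rule integrable_scaleR_left) (auto simp: assms)
  then have *: "set_integrable lborel W (\<lambda>t. 2 * L)"
    by (rule set_integrable_subset) (use W in auto)
  show int: "set_integrable lborel W (\<lambda>t. second_diff v z t / t\<^sup>2)"
    using *
  proof (rule set_integrable_bound)
    show "set_borel_measurable lborel W (\<lambda>t. second_diff v z t / t\<^sup>2)"
      unfolding set_borel_measurable_def using W(1) by measurable
    show "AE t in lborel. t \<in> W \<longrightarrow> norm (second_diff v z t / t\<^sup>2) \<le> norm (2 * L)"
      using second_quotient_le L_nonneg by auto
  qed
  have "norm (LINT t:W|lborel. second_diff v z t / t\<^sup>2) \<le> (LINT t:{0<..\<delta>}|lborel. 2 * L)"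
    unfolding set_lebesgue_integral_def
  proof (rule Bochner_Integration.integral_norm_bound_integral)
    show "integrable lborel (\<lambda>t. indicat_real W t *\<^sub>R (second_diff v z t / t\<^sup>2))"
      using int unfolding set_integrable_def .
    show "integrable lborel (\<lambda>t. indicat_real {0<..\<delta>} t *\<^sub>R (2 * L))"
      using fin unfolding set_integrable_def .
    show "norm (indicat_real W t *\<^sub>R (second_diff v z t / t\<^sup>2)) \<le> indicat_real {0<..\<delta>} t *\<^sub>R (2 * L)" for t
      using second_quotient_le[of z t] W(2) L_nonneg by (auto simp: indicator_def)
  qed
  also have "\<dots> = 2 * L * \<delta>"
    using \<open>0 \<le> \<delta>\<close> by (simp add: set_lebesgue_integral_def)
  finally show "\<bar>LINT t:W|lborel. second_diff v z t / t\<^sup>2\<bar> \<le> 2 * L * \<delta>" by simp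
qed

lemma second_quotient_integrable:
  assumes W: "W \<in> sets borel" "W \<subseteq> {0<..}"
  shows "set_integrable lborel W (\<lambda>t. second_diff v z t / t\<^sup>2)"
proof -
  have "set_integrable lborel ({0<..1} \<union> {1<..}) (\<lambda>t. second_diff v z t / t\<^sup>2)"
  proof (rule set_integrable_Un)
    show "set_integrable lborel {0<..1} (\<lambda>t. second_diff v z t / t\<^sup>2)"
      by (rule second_quotient_near(1)[of _ 1]) auto
    show "set_integrable lborel {1<..} (\<lambda>t. second_diff v z t / t\<^sup>2)"
    proof (rule kernel_integrable)
      show "(\<lambda>t. second_diff v z t) \<in> borel_measurable borel" by measurable
      show "\<bar>second_diff v z t\<bar> \<le> 4 * B" for t by (rule second_diff_bounded)
    qed auto
  qed auto
  then show ?thesis by (rule set_integrable_subset) (use W in \<open>auto simp: subset_eq not_le\<close>)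
qed

text \<open>The set \<open>T\<close> of admissible distances is a parameter so that the truncated operator (\<open>T = {..r}\<close>) and the
  full one (\<open>T = UNIV\<close>) are instances of the same computation.\<close>

lemma pv_integral_eq:
  assumes T: "T \<in> sets borel"
  shows "pv_integral {y. \<bar>y - z\<bar> \<in> T} z (\<lambda>y. (v y - v z) / (y - z)\<^sup>2)
      = (LINT t:T \<inter> {0<..}|lborel. second_diff v z t / t\<^sup>2)"
proof -
  define h where "h t = second_diff v z t / t\<^sup>2" for t
  define I where "I W = (LINT t:W|lborel. h t)" for W
  have [measurable]: "T \<in> sets borel" by fact
  have "\<bar>(LINT y:{y \<in> {y. \<bar>y - z\<bar> \<in> T}. \<delta> < \<bar>y - z\<bar>}|lborel. (v y - v z) / (y - z)\<^sup>2) - I (T \<inter> {0<..})\<bar>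
     \<le> 2 * L * \<delta>" if "0 < \<delta>" for \<delta>
  proof -
    have "{y \<in> {y. \<bar>y - z\<bar> \<in> T}. \<delta> < \<bar>y - z\<bar>} = {y. \<bar>y - z\<bar> \<in> T \<inter> {\<delta><..}}" by auto
    then have lhs: "(LINT y:{y \<in> {y. \<bar>y - z\<bar> \<in> T}. \<delta> < \<bar>y - z\<bar>}|lborel. (v y - v z) / (y - z)\<^sup>2) = I (T \<inter> {\<delta><..})"
      using punctured_integral[OF that, of "T \<inter> {\<delta><..}" z] by (simp add: I_def h_def)
    have split: "T \<inter> {0<..} = T \<inter> {0<..\<delta>} \<union> T \<inter> {\<delta><..}" using that by auto
    have I_split: "I (T \<inter> {0<..\<delta>} \<union> T \<inter> {\<delta><..}) = I (T \<inter> {0<..\<delta>}) + I (T \<inter> {\<delta><..})"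
      unfolding I_def h_def using that by (intro set_integral_Un second_quotient_integrable) auto
    have "\<bar>I (T \<inter> {0<..\<delta>})\<bar> \<le> 2 * L * \<delta>"
      unfolding I_def h_def using that by (intro second_quotient_near(2)) auto
    then show ?thesis unfolding lhs split I_split by simp
  qed
  then have "\<forall>\<^sub>F \<delta> in at_right 0. norm ((LINT y:{y \<in> {y. \<bar>y - z\<bar> \<in> T}. \<delta> < \<bar>y - z\<bar>}|lborel. (v y - v z) / (y - z)\<^sup>2) - I (T \<inter> {0<..})) \<le> 2 * L * \<delta>"
    by (intro eventually_at_right_less[THEN eventually_mono]) auto
  moreover have "((\<lambda>\<delta>. 2 * L * \<delta>) \<longlongrightarrow> 0) (at_right 0)" by (auto intro!: tendsto_eq_intros)
  ultimately have "((\<lambda>\<delta>. (LINT y:{y \<in> {y. \<bar>y - z\<bar> \<in> T}. \<delta> < \<bar>y - z\<bar>}|lborel. (v y - v z) / (y - z)\<^sup>2) - I (T \<inter> {0<..})) \<longlongrightarrow> 0) (at_right 0)"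
    by (rule Lim_null_comparison)
  then show ?thesis unfolding pv_integral_def
    by (intro tendsto_Lim) (simp_all add: LIM_zero_iff I_def h_def)
qed

end

section \<open>Level points: counting and the sum away from the singularity\<close>

text \<open>The equations \<open>v (x i) = e * i\<close> and monotonicity determine, up to a bounded error, how many of the points
  lie in an interval; this is why the level points enter as a family with these properties. The
  last two assumptions say that \<open>e * M\<close> is at most \<open>2 * e\<close> above the infimum of \<open>v\<close>, and \<open>e * N\<close> at most
  \<open>2 * e\<close> below the supremum.\<close>

locale level_points = bounded_C11 +
  fixes e :: real and M N :: int and x :: "int \<Rightarrow> real"
  assumes mono: "mono v" and e_pos: "0 < e"
    and level: "\<And>i. i \<in> {M..N} \<Longrightarrow> v (x i) = e * i"
    and low: "\<And>y. e * M \<le> v y + 2 * e" and high: "\<And>y. v y - 2 * e \<le> e * N"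
begin

text \<open>The points in an interval correspond to the multiples of \<open>e\<close> among the values of \<open>v\<close> on it. It does not
  matter which of the two end points are counted, so \<open>S\<close> is only required to lie between the open and the
  closed interval; this covers all half-open windows at once. Near the ends of the range of \<open>v\<close> some
  multiples of \<open>e\<close> are not indexed by \<open>{M..N}\<close>, which accounts for part of the error.\<close>

lemma level_count:
  assumes "a \<le> b"
    and lower: "\<And>i. i \<in> {M..N} \<Longrightarrow> a < x i \<Longrightarrow> x i < b \<Longrightarrow> i \<in> S"
    and upper: "\<And>i. i \<in> S \<Longrightarrow> i \<in> {M..N} \<and> a \<le> x i \<and> x i \<le> b"
  shows "\<bar>e * card S - (v b - v a)\<bar> \<le> 3 * e"
proof -
  have vab: "v a / e \<le> v b / e" using assms(1) mono e_pos by (simp add: monoD divide_right_mono)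
  have "S \<subseteq> {k. v a / e \<le> real_of_int k \<and> real_of_int k \<le> v b / e}"
  proof
    fix i assume "i \<in> S"
    then have "v (x i) = e * i" "v a \<le> v (x i)" "v (x i) \<le> v b"
      using upper level monoD[OF mono] by blast+
    then show "i \<in> {k. v a / e \<le> real_of_int k \<and> real_of_int k \<le> v b / e}"
      using e_pos by (auto simp: field_simps)
  qed
  from card_mono[OF finite_int_closed this]
  have "card S \<le> v b / e - v a / e + 1" using card_int_closed_le[OF vab] by linarith
  then have 1: "e * card S \<le> v b - v a + e" using e_pos by (simp add: field_simps)
  \<comment> \<open>the indices certainly counted: strictly between the two values and inside \<open>{M..N}\<close>\<close>
  define \<alpha> \<beta> where "\<alpha> = max (v a / e) (real_of_int M - 1)" and "\<beta> = min (v b / e) (real_of_int N + 1)"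
  have "{k::int. \<alpha> < k \<and> k < \<beta>} \<subseteq> S"
  proof
    fix k :: int assume k: "k \<in> {k. \<alpha> < k \<and> k < \<beta>}"
    then have kMN: "k \<in> {M..N}" by (auto simp: \<alpha>_def \<beta>_def)
    then have "v a < v (x k)" "v (x k) < v b"
      using k e_pos by (auto simp: \<alpha>_def \<beta>_def level field_simps)
    then have "a < x k" "x k < b" using monoD[OF mono] by (meson not_le)+
    then show "k \<in> S" using lower kMN by blast
  qed
  moreover have "finite S" using upper by (meson finite_atLeastAtMost_int finite_subset subsetI)
  ultimately have "\<beta> - \<alpha> - 1 \<le> card S"
    using card_int_open_ge[of \<beta> \<alpha>] by (meson card_mono of_nat_le_iff order_trans)
  moreover have "v b / e - 1 \<le> \<beta>" using high[of b] e_pos by (simp add: \<beta>_def field_simps)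
  moreover have "\<alpha> \<le> v a / e + 1" using low[of a] e_pos by (simp add: \<alpha>_def field_simps)
  ultimately have "v b / e - v a / e - 3 \<le> card S" by linarith
  then have "v b - v a - 3 * e \<le> e * card S" using e_pos by (simp add: field_simps)
  then show ?thesis using 1 e_pos by linarith
qed

lemma x_less:
  assumes "i \<in> {M..N}" "j \<in> {M..N}" "i < j"
  shows "x i < x j"
proof -
  have "v (x i) < v (x j)" using assms e_pos by (simp add: level)
  then show ?thesis using monoD[OF mono] by (meson not_le)
qed

text \<open>The slope of \<open>v\<close> is at most \<open>V\<close>, so it needs distance to rise; read backwards, the reciprocals
  \<open>e / \<bar>x i - x j\<bar>\<close> are at most \<open>V / \<bar>i - j\<bar>\<close>.\<close>

lemma x_separated:
  assumes "i \<in> {M..N}" "j \<in> {M..N}"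
  shows "e * \<bar>real_of_int (i - j)\<bar> \<le> V * \<bar>x i - x j\<bar>"
proof -
  have "\<bar>v b - v a\<bar> \<le> V * \<bar>b - a\<bar>" if "a < b" for a b
  proof -
    obtain \<xi> where "v b - v a = (b - a) * v' \<xi>" using mean_value \<open>a < b\<close> by blast
    then show ?thesis using slope_bound[of \<xi>] that by (simp add: abs_mult mult.commute mult_right_mono)
  qed
  from this[of "x i" "x j"] this[of "x j" "x i"] have "\<bar>v (x i) - v (x j)\<bar> \<le> V * \<bar>x i - x j\<bar>"
    by (cases "x i" "x j" rule: linorder_cases) (auto simp: abs_minus_commute)
  then show ?thesis using assms e_pos by (simp add: level abs_mult flip: right_diff_distrib)
qed

text \<open>Away from \<open>z\<close> the crude count of level points is good enough: it is applied to the points on the right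
  of \<open>z\<close> with \<open>G t = v (z + t) - v z\<close> and to those on the left with \<open>G t = v z - v (z - t)\<close>. The difference of
  the two main terms contains exactly the second differences of \<open>v\<close>.\<close>

lemma outer_sum:
  assumes "0 < r" "r \<le> R"
  shows "\<bar>(\<Sum>i | i \<in> {M..N} \<and> r < \<bar>x i - z\<bar> \<and> \<bar>x i - z\<bar> \<le> R. e / (x i - z))
     - (second_diff v z R / R - second_diff v z r / r + integral {r..R} (\<lambda>t. second_diff v z t / t\<^sup>2))\<bar>
     \<le> 6 * e / r"
proof -
  define P where "P = {i \<in> {M..N}. r < x i - z \<and> x i - z \<le> R}"
  define Q where "Q = {i \<in> {M..N}. r < z - x i \<and> z - x i \<le> R}"
  have fin: "finite P" "finite Q"
    unfolding P_def Q_def by (rule finite_subset[of _ "{M..N}"]; auto)+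
  let ?g = "\<lambda>t. v (z + t) - v z" and ?h = "\<lambda>t. v z - v (z - t)"
  have right: "\<bar>(\<Sum>i\<in>P. e / (x i - z)) - (?g R / R - ?g r / r + integral {r..R} (\<lambda>t. ?g t / t\<^sup>2))\<bar> \<le> 3 * e / r"
  proof (rule reciprocal_sum_approx)
    show "continuous_on {r..R} ?g"
      by (intro continuous_intros continuous_on_compose2[OF continuous[of UNIV]]) auto
    show "\<bar>e * card {i\<in>P. x i - z \<le> s} - (?g s - ?g r)\<bar> \<le> 3 * e" if "s \<in> {r..R}" for s
      using level_count[of "z + r" "z + s" "{i\<in>P. x i - z \<le> s}"] that by (auto simp: P_def algebra_simps)
  qed (use assms fin in \<open>auto simp: P_def\<close>)
  have left: "\<bar>(\<Sum>i\<in>Q. e / (z - x i)) - (?h R / R - ?h r / r + integral {r..R} (\<lambda>t. ?h t / t\<^sup>2))\<bar> \<le> 3 * e / r"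
  proof (rule reciprocal_sum_approx)
    show "continuous_on {r..R} ?h"
      by (intro continuous_intros continuous_on_compose2[OF continuous[of UNIV]]) auto
    show "\<bar>e * card {i\<in>Q. z - x i \<le> s} - (?h s - ?h r)\<bar> \<le> 3 * e" if "s \<in> {r..R}" for s
      using level_count[of "z - s" "z - r" "{i\<in>Q. z - x i \<le> s}"] that by (auto simp: Q_def algebra_simps)
  qed (use assms fin in \<open>auto simp: Q_def\<close>)
  have sum: "(\<Sum>i | i \<in> {M..N} \<and> r < \<bar>x i - z\<bar> \<and> \<bar>x i - z\<bar> \<le> R. e / (x i - z))
      = (\<Sum>i\<in>P. e / (x i - z)) - (\<Sum>i\<in>Q. e / (z - x i))"
  proof -
    have "{i. i \<in> {M..N} \<and> r < \<bar>x i - z\<bar> \<and> \<bar>x i - z\<bar> \<le> R} = P \<union> Q" "P \<inter> Q = {}" 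
      using assms(1) by (auto simp: P_def Q_def)
    moreover have "(\<Sum>i\<in>Q. e / (z - x i)) = - (\<Sum>i\<in>Q. e / (x i - z))"
      unfolding sum_negf[symmetric] by (intro sum.cong) (auto simp: minus_divide_right)
    ultimately show ?thesis using fin by (simp add: sum.union_disjoint)
  qed
  have int: "integral {r..R} (\<lambda>t. second_diff v z t / t\<^sup>2)
      = integral {r..R} (\<lambda>t. ?g t / t\<^sup>2) - integral {r..R} (\<lambda>t. ?h t / t\<^sup>2)"
  proof (subst Henstock_Kurzweil_Integration.integral_diff[symmetric])
    show "(\<lambda>t. ?g t / t\<^sup>2) integrable_on {r..R}" "(\<lambda>t. ?h t / t\<^sup>2) integrable_on {r..R}"
      using assms by (auto intro!: integrable_continuous_interval continuous_intros continuous_on_compose2[OF continuous[of UNIV]])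
    show "integral {r..R} (\<lambda>t. second_diff v z t / t\<^sup>2) = integral {r..R} (\<lambda>t. ?g t / t\<^sup>2 - ?h t / t\<^sup>2)"
      by (simp flip: diff_divide_distrib add: algebra_simps)
  qed
  have quot: "second_diff v z t / t = ?g t / t - ?h t / t" for t
    by (simp flip: diff_divide_distrib add: algebra_simps)
  have "\<bar>s1 - s2 - ((a1 - a2) - (b1 - b2) + (c1 - c2))\<bar> \<le> K + K"
    if "\<bar>s1 - (a1 - b1 + c1)\<bar> \<le> K" "\<bar>s2 - (a2 - b2 + c2)\<bar> \<le> K" for s1 s2 a1 a2 b1 b2 c1 c2 K :: real
    using that by linarith
  from this[OF right left] show ?thesis
    unfolding sum int quot by (simp flip: add_divide_distrib)
qed

text \<open>This is the only source of the term \<open>O(\<gamma>)\<close>. Moving the pole from \<open>z\<close> to \<open>x i0\<close> changes each summand by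
  \<open>e\<^sup>2 * \<gamma> / ((x i - z) * (x i - x i0))\<close>. As \<open>x i0\<close> is the nearest level point, \<open>x i\<close> is at least half as far
  from \<open>z\<close> as from \<open>x i0\<close>, and by separation the changes are dominated by \<open>\<gamma> / (i - i0)\<^sup>2\<close>, which is
  summable.\<close>

lemma recentre_sum:
  assumes i0: "i0 \<in> {M..N}" and closest: "\<And>i. i \<in> {M..N} \<Longrightarrow> \<bar>x i0 - z\<bar> \<le> \<bar>x i - z\<bar>"
    and z: "z = x i0 + e * \<gamma>" and F: "F \<subseteq> {M..N} - {i0}"
  shows "\<bar>(\<Sum>i\<in>F. e / (x i - z)) - (\<Sum>i\<in>F. e / (x i - x i0))\<bar> \<le> 8 * V\<^sup>2 * \<bar>\<gamma>\<bar>"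
proof -
  have termwise: "\<bar>e / (x i - z) - e / (x i - x i0)\<bar> \<le> 2 * V\<^sup>2 * \<bar>\<gamma>\<bar> * (1 / (real_of_int (i - i0))\<^sup>2)"
    if "i \<in> F" for i
  proof -
    define u k where "u = \<bar>x i - x i0\<bar>" and "k = \<bar>real_of_int (i - i0)\<bar>"
    have iMN: "i \<in> {M..N}" "i \<noteq> i0" using that F by auto
    have k: "0 < k" using iMN by (simp add: k_def)
    have ku: "e * k \<le> V * u" using x_separated[OF iMN(1) i0] by (simp add: k_def u_def)
    then have u: "0 < u" using k e_pos by (metis abs_ge_zero mult_pos_pos mult_zero_right not_le order_le_less u_def)
    have w: "u \<le> 2 * \<bar>x i - z\<bar>" using closest[OF iMN(1)] abs_triangle_ineq4[of "x i - z" "x i0 - z"] by (simp add: u_def)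
    have "x i - z \<noteq> 0" "x i - x i0 \<noteq> 0" using u w by (auto simp: u_def)
    then have "e / (x i - z) - e / (x i - x i0) = e * ((x i - x i0) - (x i - z)) / ((x i - z) * (x i - x i0))"
      by (simp add: diff_frac_eq right_diff_distrib mult_ac)
    also have "(x i - x i0) - (x i - z) = e * \<gamma>" using z by simp
    finally have "e / (x i - z) - e / (x i - x i0) = e * (e * \<gamma>) / ((x i - z) * (x i - x i0))" .
    then have "\<bar>e / (x i - z) - e / (x i - x i0)\<bar> = e\<^sup>2 * \<bar>\<gamma>\<bar> / (\<bar>x i - z\<bar> * u)"
      using e_pos by (simp add: abs_mult abs_divide u_def power2_eq_square)
    also have "\<dots> \<le> e\<^sup>2 * \<bar>\<gamma>\<bar> / (u / 2 * u)"
      using u w by (intro divide_left_mono mult_right_mono mult_pos_pos) auto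
    also have "\<dots> = 2 * \<bar>\<gamma>\<bar> * (e / u)\<^sup>2" by (simp add: power2_eq_square field_simps)
    also have "\<dots> \<le> 2 * \<bar>\<gamma>\<bar> * (V / k)\<^sup>2"
    proof -
      have "e / u \<le> V / k" using ku u k by (simp add: field_simps)
      then show ?thesis using e_pos u by (intro mult_left_mono power_mono) auto
    qed
    also have "\<dots> = 2 * V\<^sup>2 * \<bar>\<gamma>\<bar> * (1 / (real_of_int (i - i0))\<^sup>2)" by (simp add: k_def power_divide)
    finally show ?thesis .
  qed
  have "(\<Sum>i\<in>F. 1 / (real_of_int (i - i0))\<^sup>2) \<le> 4"
  proof -
    define n where "n = nat (N - M)"
    have "(\<Sum>i\<in>F. 1 / (real_of_int (i - i0))\<^sup>2) = (\<Sum>k\<in>(\<lambda>i. i - i0) ` F. 1 / (real_of_int k)\<^sup>2)"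
      by (subst sum.reindex) (auto simp: inj_on_def)
    also have "\<dots> \<le> (\<Sum>k\<in>{- int n..int n} - {0}. 1 / (real_of_int k)\<^sup>2)"
      using F i0 by (intro sum_mono2) (auto simp: n_def)
    also have "\<dots> = 2 * (\<Sum>k=1..n. 1 / (real k)\<^sup>2)" by (subst sum_symmetric_int) auto
    also have "\<dots> \<le> 4" using sum_inverse_squares_le[of n] by simp
    finally show ?thesis .
  qed
  then have "2 * V\<^sup>2 * \<bar>\<gamma>\<bar> * (\<Sum>i\<in>F. 1 / (real_of_int (i - i0))\<^sup>2) \<le> 2 * V\<^sup>2 * \<bar>\<gamma>\<bar> * 4"
    by (intro mult_left_mono) auto
  moreover have "\<bar>\<Sum>i\<in>F. e / (x i - z) - e / (x i - x i0)\<bar> \<le> (\<Sum>i\<in>F. 2 * V\<^sup>2 * \<bar>\<gamma>\<bar> * (1 / (real_of_int (i - i0))\<^sup>2))"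
    using termwise by (intro sum_norm_le[where 'a = real, simplified real_norm_def])
  ultimately show ?thesis by (simp add: sum_subtractf sum_distrib_left)
qed

end

section \<open>The sum near the singularity\<close>

text \<open>The first summand bounds the error of the linearisation inside the window, the second one the unpaired
  terms; the last one collects the outer sum, the omitted index and the continuous counterpart of the
  window.\<close>

definition (in bounded_C11) remainder :: "real \<Rightarrow> real" where
  "remainder r = 8 * L * sqrt (2 * V * r) + (12 + 2 * L) * (9 + 3 * L) * r + (7 + 4 * L) * r"

context level_points
begin

lemma slope_nonneg: "0 \<le> v' y"
  using mono_on_imp_deriv_nonneg[of UNIV v "v' y" y] mono has_deriv by auto

text \<open>With \<open>k = i - i0\<close> and \<open>u = x i - x i0\<close>, Taylor expansion gives \<open>e * k = p * u + O(L * u\<^sup>2)\<close>, where \<open>p\<close> is the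
  slope at \<open>x i0\<close>; dividing by \<open>u * k\<close> turns this into \<open>e / u = p / k + O(L * \<bar>u\<bar> / \<bar>k\<bar>)\<close>. The
  bound is uniform in \<open>p\<close>, so flat and steep parts of \<open>v\<close> are treated alike. Separation bounds \<open>\<bar>k\<bar>\<close> by \<open>2 * V / r\<close>, and the
  errors add up to \<open>o(1)\<close>.\<close>

lemma linearised_sum:
  assumes i0: "i0 \<in> {M..N}" and r: "0 < r" "r\<^sup>2 = e"
    and F: "F \<subseteq> {M..N} - {i0}" "\<And>i. i \<in> F \<Longrightarrow> \<bar>x i - x i0\<bar> \<le> 2 * r"
  shows "\<bar>(\<Sum>i\<in>F. e / (x i - x i0)) - v' (x i0) * (\<Sum>i\<in>F. 1 / real_of_int (i - i0))\<bar>
     \<le> 8 * L * sqrt (2 * V * r)"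
proof -
  have termwise: "\<bar>e / (x i - x i0) - v' (x i0) * (1 / real_of_int (i - i0))\<bar> \<le> 2 * r * L * (1 / \<bar>real_of_int (i - i0)\<bar>)"
    if "i \<in> F" for i
  proof -
    define u k where "u = x i - x i0" and "k = real_of_int (i - i0)"
    have iMN: "i \<in> {M..N}" "i \<noteq> i0" using that F by auto
    have k: "k \<noteq> 0" using iMN by (simp add: k_def)
    have u: "u \<noteq> 0" using x_less[of i i0] x_less[of i0 i] iMN i0
      by (cases i i0 rule: linorder_cases) (auto simp: u_def)
    have "e * k = v (x i) - v (x i0)" using iMN i0 by (simp add: level k_def algebra_simps)
    then have "\<bar>e * k - v' (x i0) * u\<bar> \<le> L * u\<^sup>2" using taylor[of "x i" "x i0"] by (simp add: u_def)
    then have "\<bar>e * k - v' (x i0) * u\<bar> / (\<bar>u\<bar> * \<bar>k\<bar>) \<le> L * u\<^sup>2 / (\<bar>u\<bar> * \<bar>k\<bar>)"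
      by (intro divide_right_mono) auto
    moreover have "\<bar>e / u - v' (x i0) * (1 / k)\<bar> = \<bar>e * k - v' (x i0) * u\<bar> / (\<bar>u\<bar> * \<bar>k\<bar>)"
      using u k by (simp add: diff_frac_eq abs_divide abs_mult)
    moreover have "L * u\<^sup>2 / (\<bar>u\<bar> * \<bar>k\<bar>) = L * \<bar>u\<bar> / \<bar>k\<bar>"
      using u k by (simp add: power2_eq_square field_simps abs_if)
    moreover have "L * \<bar>u\<bar> / \<bar>k\<bar> \<le> L * (2 * r) / \<bar>k\<bar>"
      using F(2)[OF that] L_nonneg by (intro divide_right_mono mult_left_mono) (auto simp: u_def)
    ultimately show ?thesis by (simp add: u_def k_def mult_ac)
  qed
  have "(\<Sum>i\<in>F. 1 / \<bar>real_of_int (i - i0)\<bar>) \<le> 4 * sqrt (2 * V / r)"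
  proof -
    define n where "n = nat \<lfloor>2 * V / r\<rfloor>"
    have n: "real n \<le> 2 * V / r" using r V_nonneg by (simp add: n_def)
    have range: "\<bar>i - i0\<bar> \<le> int n" if "i \<in> F" for i
    proof -
      have "r\<^sup>2 * \<bar>real_of_int (i - i0)\<bar> \<le> V * \<bar>x i - x i0\<bar>" using x_separated[of i i0] that F(1) i0 r by auto
      also have "\<dots> \<le> V * (2 * r)" using F(2)[OF that] V_nonneg by (rule mult_left_mono)
      finally have "real_of_int \<bar>i - i0\<bar> \<le> 2 * V / r" using r by (simp add: field_simps power2_eq_square)
      then have "\<bar>i - i0\<bar> \<le> \<lfloor>2 * V / r\<rfloor>" by (simp add: le_floor_iff)
      then show ?thesis using r V_nonneg by (simp add: n_def)
    qed
    have "(\<Sum>i\<in>F. 1 / \<bar>real_of_int (i - i0)\<bar>) = (\<Sum>k\<in>(\<lambda>i. i - i0) ` F. 1 / \<bar>real_of_int k\<bar>)"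
      by (subst sum.reindex) (auto simp: inj_on_def)
    also have "\<dots> \<le> (\<Sum>k\<in>{- int n..int n} - {0}. 1 / \<bar>real_of_int k\<bar>)"
    proof (rule sum_mono2)
      show "(\<lambda>i. i - i0) ` F \<subseteq> {- int n..int n} - {0}"
      proof
        fix k assume "k \<in> (\<lambda>i. i - i0) ` F"
        then obtain i where i: "i \<in> F" "k = i - i0" by blast
        have "i \<noteq> i0" using i(1) F(1) by blast
        moreover have "\<bar>k\<bar> \<le> int n" using range[OF i(1)] i(2) by simp
        moreover from this have "- int n \<le> k" "k \<le> int n" by linarith+
        ultimately show "k \<in> {- int n..int n} - {0}" using i(2) by simp
      qed
    qed auto
    also have "\<dots> = 2 * (\<Sum>k=1..n. 1 / real k)" by (subst sum_symmetric_int) auto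
    also have "\<dots> \<le> 4 * sqrt n" using sum_reciprocals_le_sqrt[of n] by simp
    also have "\<dots> \<le> 4 * sqrt (2 * V / r)" using n by simp
    finally show ?thesis .
  qed
  then have "2 * r * L * (\<Sum>i\<in>F. 1 / \<bar>real_of_int (i - i0)\<bar>) \<le> 2 * r * L * (4 * sqrt (2 * V / r))"
    using r L_nonneg by (intro mult_left_mono) auto
  also have "\<dots> = 8 * L * sqrt (2 * V * r)"
  proof -
    have "r * sqrt (2 * V / r) = sqrt (r\<^sup>2 * (2 * V / r))" using r(1) by (simp only: real_sqrt_mult real_sqrt_abs abs_of_pos)
    also have "r\<^sup>2 * (2 * V / r) = 2 * V * r" using r(1) by (simp add: power2_eq_square)
    finally show ?thesis by simp
  qed
  finally have "2 * r * L * (\<Sum>i\<in>F. 1 / \<bar>real_of_int (i - i0)\<bar>) \<le> 8 * L * sqrt (2 * V * r)" .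
  moreover have "\<bar>\<Sum>i\<in>F. e / (x i - x i0) - v' (x i0) * (1 / real_of_int (i - i0))\<bar>
      \<le> (\<Sum>i\<in>F. 2 * r * L * (1 / \<bar>real_of_int (i - i0)\<bar>))"
    using termwise by (intro sum_norm_le[where 'a = real, simplified real_norm_def])
  ultimately show ?thesis by (simp add: sum_subtractf sum_distrib_left)
qed

text \<open>The numbers \<open>a\<close> and \<open>b\<close> of level points in the window on the two sides of \<open>x i0\<close> satisfy
  \<open>e * (b - a) = second_diff v z r + O(e)\<close>, and the second difference is \<open>O(r\<^sup>2) = O(e)\<close>; hence the imbalance
  \<open>\<bar>b - a\<bar>\<close> is bounded. The few unpaired terms are small: up to \<open>O(e)\<close>, \<open>e * (a + b)\<close> is the increment of \<open>v\<close>
  over a window of length \<open>2 * r\<close>, which is at least \<open>2 * r * p - O(e)\<close>, so \<open>p / (min a b + 1)\<close> is \<open>O(e / r) = O(r)\<close>.\<close>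

lemma balanced_window:
  assumes i0: "i0 \<in> {M..N}" and closest: "\<And>i. i \<in> {M..N} \<Longrightarrow> \<bar>x i0 - z\<bar> \<le> \<bar>x i - z\<bar>"
    and r: "0 < r" "r\<^sup>2 = e" and near: "\<bar>x i0 - z\<bar> \<le> r"
  shows "v' (x i0) * \<bar>\<Sum>i\<in>{i \<in> {M..N}. \<bar>x i - z\<bar> \<le> r} - {i0}. 1 / real_of_int (i - i0)\<bar>
     \<le> (12 + 2 * L) * (9 + 3 * L) * r"
proof -
  define S where "S = {i \<in> {M..N}. \<bar>x i - z\<bar> \<le> r}"
  define a where "a = real (card {i\<in>S. i < i0})"
  define b where "b = real (card {i\<in>S. i0 < i})"
  define p where "p = v' (x i0)"
  have order: "x i < x j \<longleftrightarrow> i < j" if "i \<in> {M..N}" "j \<in> {M..N}" for i j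
    using x_less[of i j] x_less[of j i] that by (cases i j rule: linorder_cases) auto
  have sum: "\<bar>\<Sum>i\<in>S - {i0}. 1 / real_of_int (i - i0)\<bar> \<le> \<bar>b - a\<bar> / (min a b + 1)"
    unfolding a_def b_def
  proof (rule reciprocal_sum_int_interval)
    show "finite S" unfolding S_def by (rule finite_subset[of _ "{M..N}"]) auto
    fix i j assume "i \<in> S"
    { assume "i0 < j" "j \<le> i"
      then have "j \<in> {M..N}" "x i0 < x j" "x j \<le> x i"
        using \<open>i \<in> S\<close> i0 order[of i j] order[of i0 j] by (auto simp: S_def not_less[symmetric])
      then show "j \<in> S" using near \<open>i \<in> S\<close> by (auto simp: S_def) }
    { assume "j < i0" "i \<le> j"
      then have "j \<in> {M..N}" "x j < x i0" "x i \<le> x j"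
        using \<open>i \<in> S\<close> i0 order[of j i] order[of j i0] by (auto simp: S_def not_less[symmetric])
      then show "j \<in> S" using near \<open>i \<in> S\<close> by (auto simp: S_def) }
  qed
  have window: "z - r \<le> x i0" "x i0 \<le> z + r" using near by (auto simp: abs_le_iff)
  have b: "\<bar>e * b - (v (z + r) - v (x i0))\<bar> \<le> 3 * e"
    unfolding b_def
  proof (rule level_count)
    show "i \<in> {i\<in>S. i0 < i}" if "i \<in> {M..N}" "x i0 < x i" "x i < z + r" for i
      using that window order[OF i0 that(1)] by (auto simp: S_def abs_le_iff)
  qed (use window i0 order[of i0] in \<open>auto simp: S_def abs_le_iff less_imp_le\<close>)
  have a: "\<bar>e * a - (v (x i0) - v (z - r))\<bar> \<le> 3 * e"
    unfolding a_def
  proof (rule level_count)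
    show "i \<in> {i\<in>S. i < i0}" if "i \<in> {M..N}" "z - r < x i" "x i < x i0" for i
      using that window order[OF that(1) i0] by (auto simp: S_def abs_le_iff)
  qed (use window i0 order[of _ i0] in \<open>auto simp: S_def abs_le_iff less_imp_le\<close>)
  \<comment> \<open>no level point lies strictly between \<open>z\<close> and the nearest one\<close>
  have "\<bar>v z - v (x i0)\<bar> \<le> 3 * e"
  proof (cases "x i0 \<le> z")
    case True
    have "\<bar>e * card ({} :: int set) - (v z - v (x i0))\<bar> \<le> 3 * e"
      by (rule level_count[OF True]) (use closest True in force)+
    then show ?thesis by simp
  next
    case False
    then have le: "z \<le> x i0" by simp
    have "\<bar>e * card ({} :: int set) - (v (x i0) - v z)\<bar> \<le> 3 * e"
      by (rule level_count[OF le]) (use closest le in force)+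
    then show ?thesis by simp
  qed
  moreover have "\<bar>second_diff v z r\<bar> \<le> 2 * L * e" using second_diff_le[of z r] r by simp
  moreover have "e * b - e * a = e * (b - a)" by (simp add: algebra_simps)
  ultimately have "\<bar>e * (b - a)\<bar> \<le> e * (12 + 2 * L)" using a b by (simp add: algebra_simps)
  then have ba: "\<bar>b - a\<bar> \<le> 12 + 2 * L" using e_pos by (simp add: abs_mult)
  have "z - r < z + r" using r by simp
  then obtain \<xi> where \<xi>: "z - r < \<xi>" "\<xi> < z + r" "v (z + r) - v (z - r) = 2 * r * v' \<xi>"
    by (rule mean_value) auto
  have "\<bar>v' \<xi> - p\<bar> \<le> L * (2 * r)"
    using lip[of \<xi> "x i0"] \<xi> near L_nonneg unfolding p_def
    by (elim order_trans) (auto intro!: mult_left_mono)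
  then have "r * p \<le> r * v' \<xi> + r * (L * (2 * r))" using r by (simp flip: distrib_left)
  then have "2 * (r * p) \<le> v (z + r) - v (z - r) + 4 * L * e"
    unfolding \<xi>(3) r(2)[symmetric] by (simp add: power2_eq_square mult_ac)
  also have "\<dots> \<le> e * (a + b + 6 + 4 * L)" using a b by (simp add: algebra_simps)
  also have "\<dots> \<le> e * (2 * ((9 + 3 * L) * (min a b + 1)))"
  proof (rule mult_left_mono)
    have "0 \<le> min a b * (16 + 6 * L)" using L_nonneg by (simp add: a_def b_def)
    then show "a + b + 6 + 4 * L \<le> 2 * ((9 + 3 * L) * (min a b + 1))"
      using ba by (simp add: algebra_simps min_def split: if_splits)
  qed (use e_pos in auto)
  finally have "r * p \<le> r * (r * (9 + 3 * L) * (min a b + 1))"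
    unfolding r(2)[symmetric] by (simp add: power2_eq_square mult_ac)
  then have "p \<le> r * (9 + 3 * L) * (min a b + 1)" using r by simp
  moreover have "0 < min a b + 1" by (simp add: a_def b_def add_nonneg_pos)
  ultimately have p: "p / (min a b + 1) \<le> r * (9 + 3 * L)" by (simp add: divide_le_eq)
  have "0 \<le> p" by (simp add: p_def slope_nonneg)
  then have "p * \<bar>\<Sum>i\<in>S - {i0}. 1 / real_of_int (i - i0)\<bar> \<le> p * (\<bar>b - a\<bar> / (min a b + 1))"
    using sum by (rule mult_left_mono[rotated])
  also have "\<dots> = \<bar>b - a\<bar> * (p / (min a b + 1))" by simp
  also have "\<dots> \<le> (12 + 2 * L) * (r * (9 + 3 * L))"
    using ba p \<open>0 \<le> p\<close> \<open>0 < min a b + 1\<close> L_nonneg by (intro mult_mono) auto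
  finally show ?thesis by (simp add: S_def p_def mult_ac)
qed

text \<open>If the window contains any level point other than \<open>x i0\<close>, then it contains \<open>x i0\<close> too, and the three
  preceding estimates apply; otherwise the sum is empty.\<close>

lemma inner_sum:
  assumes i0: "i0 \<in> {M..N}" and closest: "\<And>i. i \<in> {M..N} \<Longrightarrow> \<bar>x i0 - z\<bar> \<le> \<bar>x i - z\<bar>"
    and z: "z = x i0 + e * \<gamma>" and r: "0 < r" "r\<^sup>2 = e"
  shows "\<bar>\<Sum>i | i \<in> {M..N} \<and> i \<noteq> i0 \<and> \<bar>x i - z\<bar> \<le> r. e / (x i - z)\<bar>
     \<le> 8 * V\<^sup>2 * \<bar>\<gamma>\<bar> + (8 * L * sqrt (2 * V * r) + (12 + 2 * L) * (9 + 3 * L) * r)"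
proof -
  define F where "F = {i \<in> {M..N}. \<bar>x i - z\<bar> \<le> r} - {i0}"
  have F: "{i. i \<in> {M..N} \<and> i \<noteq> i0 \<and> \<bar>x i - z\<bar> \<le> r} = F" by (auto simp: F_def)
  show ?thesis unfolding F
  proof (cases "F = {}")
    case True
    then show "\<bar>\<Sum>i\<in>F. e / (x i - z)\<bar> \<le> 8 * V\<^sup>2 * \<bar>\<gamma>\<bar> + (8 * L * sqrt (2 * V * r) + (12 + 2 * L) * (9 + 3 * L) * r)"
      using L_nonneg V_nonneg r by simp
  next
    case False
    then obtain j where "j \<in> F" by blast
    then have near: "\<bar>x i0 - z\<bar> \<le> r" using closest[of j] by (auto simp: F_def)
    have "\<bar>x i - x i0\<bar> \<le> 2 * r" if "i \<in> F" for i using that near by (auto simp: F_def)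
    moreover have "F \<subseteq> {M..N} - {i0}" by (auto simp: F_def)
    ultimately have "\<bar>(\<Sum>i\<in>F. e / (x i - x i0)) - v' (x i0) * (\<Sum>i\<in>F. 1 / real_of_int (i - i0))\<bar> \<le> 8 * L * sqrt (2 * V * r)"
      by (intro linearised_sum[OF i0 r])
    moreover have "\<bar>(\<Sum>i\<in>F. e / (x i - z)) - (\<Sum>i\<in>F. e / (x i - x i0))\<bar> \<le> 8 * V\<^sup>2 * \<bar>\<gamma>\<bar>"
      by (rule recentre_sum[OF i0 closest z]) (auto simp: F_def)
    moreover have "\<bar>v' (x i0) * (\<Sum>i\<in>F. 1 / real_of_int (i - i0))\<bar> \<le> (12 + 2 * L) * (9 + 3 * L) * r"
      using balanced_window[OF i0 closest r near] slope_nonneg by (simp add: F_def abs_mult)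
    ultimately show "\<bar>\<Sum>i\<in>F. e / (x i - z)\<bar> \<le> 8 * V\<^sup>2 * \<bar>\<gamma>\<bar> + (8 * L * sqrt (2 * V * r) + (12 + 2 * L) * (9 + 3 * L) * r)"
      by linarith
  qed
qed

text \<open>The outer sum also counts \<open>i0\<close> when \<open>x i0\<close> is outside the window; that term is at most \<open>e / r = r\<close>.
  Extending the integral of the second quotient from \<open>[r, R]\<close> down to \<open>0\<close> costs \<open>2 * L * r\<close>, and so does the
  boundary term at \<open>r\<close>.\<close>

lemma truncated_sum:
  assumes i0: "i0 \<in> {M..N}" and closest: "\<And>i. i \<in> {M..N} \<Longrightarrow> \<bar>x i0 - z\<bar> \<le> \<bar>x i - z\<bar>"
    and z: "z = x i0 + e * \<gamma>" and r: "0 < r" "r\<^sup>2 = e" "r \<le> R"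
  shows "\<bar>(\<Sum>i | i \<in> {M..N} \<and> i \<noteq> i0 \<and> \<bar>x i - z\<bar> \<le> R. e / (x i - z))
      - ((LINT t:{0<..R}|lborel. second_diff v z t / t\<^sup>2) + second_diff v z R / R)\<bar>
     \<le> 8 * V\<^sup>2 * \<bar>\<gamma>\<bar> + remainder r"
proof -
  let ?s = "\<lambda>i. e / (x i - z)"
  define Near where "Near = {i. i \<in> {M..N} \<and> i \<noteq> i0 \<and> \<bar>x i - z\<bar> \<le> r}"
  define Far where "Far = {i. i \<in> {M..N} \<and> r < \<bar>x i - z\<bar> \<and> \<bar>x i - z\<bar> \<le> R}"
  have fin: "finite Near" "finite Far"
    unfolding Near_def Far_def by (rule finite_subset[of _ "{M..N}"]; auto)+
  have er: "e / r = r" unfolding r(2)[symmetric] using r(1) by (simp add: power2_eq_square)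
  have "{i. i \<in> {M..N} \<and> i \<noteq> i0 \<and> \<bar>x i - z\<bar> \<le> R} = Near \<union> (Far - {i0})" "Near \<inter> (Far - {i0}) = {}"
    using r by (auto simp: Near_def Far_def)
  then have total: "(\<Sum>i | i \<in> {M..N} \<and> i \<noteq> i0 \<and> \<bar>x i - z\<bar> \<le> R. ?s i) = sum ?s Near + sum ?s (Far - {i0})"
    using fin by (simp add: sum.union_disjoint)
  have skip: "\<bar>sum ?s Far - sum ?s (Far - {i0})\<bar> \<le> r"
  proof (cases "i0 \<in> Far")
    case True
    then have "\<bar>?s i0\<bar> \<le> e / r" using r e_pos by (auto simp: Far_def abs_divide intro!: divide_left_mono)
    then show ?thesis using True fin by (simp add: sum.remove[of Far i0] er)
  qed (use r in simp)
  have inner: "\<bar>sum ?s Near\<bar> \<le> 8 * V\<^sup>2 * \<bar>\<gamma>\<bar> + (8 * L * sqrt (2 * V * r) + (12 + 2 * L) * (9 + 3 * L) * r)"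
    unfolding Near_def by (rule inner_sum[OF i0 closest z r(1,2)])
  have outer: "\<bar>sum ?s Far - (second_diff v z R / R - second_diff v z r / r
      + integral {r..R} (\<lambda>t. second_diff v z t / t\<^sup>2))\<bar> \<le> 6 * r"
    using outer_sum[OF r(1,3), of z] unfolding times_divide_eq_right[symmetric] er Far_def[symmetric] .
  have boundary: "\<bar>second_diff v z r / r\<bar> \<le> 2 * L * r"
    using second_diff_le[of z r] r(1) by (simp add: abs_divide divide_le_eq power2_eq_square mult.assoc)
  have core: "\<bar>(LINT t:{0<..R}|lborel. second_diff v z t / t\<^sup>2) - integral {r..R} (\<lambda>t. second_diff v z t / t\<^sup>2)\<bar> \<le> 2 * L * r"
  proof -
    have "{0<..R} = {0<..<r} \<union> {r..R}" using r by auto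
    moreover have "(LINT t:{0<..<r} \<union> {r..R}|lborel. second_diff v z t / t\<^sup>2)
        = (LINT t:{0<..<r}|lborel. second_diff v z t / t\<^sup>2) + (LINT t:{r..R}|lborel. second_diff v z t / t\<^sup>2)"
      using r by (intro set_integral_Un second_quotient_integrable) auto
    moreover have "(LINT t:{r..R}|lborel. second_diff v z t / t\<^sup>2) = integral {r..R} (\<lambda>t. second_diff v z t / t\<^sup>2)"
      using r by (intro set_borel_integral_eq_integral second_quotient_integrable) auto
    moreover have "\<bar>LINT t:{0<..<r}|lborel. second_diff v z t / t\<^sup>2\<bar> \<le> 2 * L * r"
      using r by (intro second_quotient_near(2)) auto
    ultimately show ?thesis by simp
  qed
  have combine: "\<bar>a + o1 - (I + bR)\<bar> \<le> k1 + (k2 + k3) + (7 + 4 * L) * r"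
    if "\<bar>o0 - o1\<bar> \<le> r" "\<bar>a\<bar> \<le> k1 + (k2 + k3)" "\<bar>o0 - (bR - br + J)\<bar> \<le> 6 * r" "\<bar>br\<bar> \<le> 2 * L * r" "\<bar>I - J\<bar> \<le> 2 * L * r"
    for a o0 o1 bR br I J k1 k2 k3 :: real
    using that unfolding distrib_right by linarith
  show ?thesis unfolding total remainder_def
    using combine[OF skip inner outer boundary core] by (simp only: add.assoc)
qed

text \<open>The error of the truncated sum does not depend on \<open>R\<close>, so \<open>R\<close> may tend to infinity: the sum is eventually
  complete, the integral converges, and the boundary term at \<open>R\<close> vanishes because \<open>v\<close> is bounded.\<close>

lemma full_sum:
  assumes i0: "i0 \<in> {M..N}" and closest: "\<And>i. i \<in> {M..N} \<Longrightarrow> \<bar>x i0 - z\<bar> \<le> \<bar>x i - z\<bar>"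
    and z: "z = x i0 + e * \<gamma>" and r: "0 < r" "r\<^sup>2 = e"
  shows "\<bar>(\<Sum>i | i \<in> {M..N} \<and> i \<noteq> i0. e / (x i - z)) - (LINT t:{0<..}|lborel. second_diff v z t / t\<^sup>2)\<bar>
     \<le> 8 * V\<^sup>2 * \<bar>\<gamma>\<bar> + remainder r"
proof -
  let ?h = "\<lambda>t. second_diff v z t / t\<^sup>2" and ?s = "\<lambda>i. e / (x i - z)"
  have "((\<lambda>R. LINT t:{r..R}|lborel. ?h t) \<longlongrightarrow> (LINT t:{r..}|lborel. ?h t)) at_top"
    using r by (intro tendsto_set_lebesgue_integral_at_top second_quotient_integrable) auto
  then have "((\<lambda>R. (LINT t:{0<..<r}|lborel. ?h t) + (LINT t:{r..R}|lborel. ?h t))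
      \<longlongrightarrow> (LINT t:{0<..<r}|lborel. ?h t) + (LINT t:{r..}|lborel. ?h t)) at_top"
    by (intro tendsto_add tendsto_const)
  moreover have "(LINT t:{0<..<r}|lborel. ?h t) + (LINT t:{r..}|lborel. ?h t) = (LINT t:{0<..}|lborel. ?h t)"
  proof -
    have split: "{0<..} = {0<..<r} \<union> {r..}" using r(1) by auto
    show ?thesis unfolding split
      by (rule set_integral_Un[symmetric]; (rule second_quotient_integrable)?) (use r(1) in auto)
  qed
  ultimately have "((\<lambda>R. (LINT t:{0<..<r}|lborel. ?h t) + (LINT t:{r..R}|lborel. ?h t))
      \<longlongrightarrow> (LINT t:{0<..}|lborel. ?h t)) at_top"
    by (rule back_subst)
  moreover have "\<forall>\<^sub>F R in at_top. (LINT t:{0<..<r}|lborel. ?h t) + (LINT t:{r..R}|lborel. ?h t) = (LINT t:{0<..R}|lborel. ?h t)"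
    using eventually_ge_at_top[of r]
  proof (rule eventually_mono)
    fix R assume "r \<le> R"
    then have split: "{0<..R} = {0<..<r} \<union> {r..R}" using r(1) by auto
    show "(LINT t:{0<..<r}|lborel. ?h t) + (LINT t:{r..R}|lborel. ?h t) = (LINT t:{0<..R}|lborel. ?h t)"
      unfolding split
      by (rule set_integral_Un[symmetric]; (rule second_quotient_integrable)?) (use r(1) in auto)
  qed
  ultimately have "((\<lambda>R. LINT t:{0<..R}|lborel. ?h t) \<longlongrightarrow> (LINT t:{0<..}|lborel. ?h t)) at_top"
    by (rule Lim_transform_eventually)
  moreover have "((\<lambda>R. second_diff v z R / R) \<longlongrightarrow> 0) at_top"
  proof (rule Lim_null_comparison)
    show "\<forall>\<^sub>F R in at_top. norm (second_diff v z R / R) \<le> 4 * B / R"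
      using eventually_gt_at_top[of 0]
      by eventually_elim (use second_diff_bounded in \<open>auto simp: abs_divide intro!: divide_right_mono\<close>)
    show "((\<lambda>R. 4 * B / R) \<longlongrightarrow> 0) at_top"
      by (intro tendsto_divide_0[OF tendsto_const] filterlim_at_top_imp_at_infinity filterlim_ident)
  qed
  ultimately have "((\<lambda>R. \<bar>(\<Sum>i | i \<in> {M..N} \<and> i \<noteq> i0. ?s i) - ((LINT t:{0<..R}|lborel. ?h t) + second_diff v z R / R)\<bar>)
      \<longlongrightarrow> \<bar>(\<Sum>i | i \<in> {M..N} \<and> i \<noteq> i0. ?s i) - ((LINT t:{0<..}|lborel. ?h t) + 0)\<bar>) at_top"
    by (intro tendsto_intros)
  moreover have "\<forall>\<^sub>F R in at_top. \<bar>(\<Sum>i | i \<in> {M..N} \<and> i \<noteq> i0. ?s i) - ((LINT t:{0<..R}|lborel. ?h t) + second_diff v z R / R)\<bar>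
      \<le> 8 * V\<^sup>2 * \<bar>\<gamma>\<bar> + remainder r"
  proof -
    define R0 where "R0 = Max (insert r ((\<lambda>i. \<bar>x i - z\<bar>) ` {M..N}))"
    show ?thesis using eventually_ge_at_top[of R0]
    proof eventually_elim
      case (elim R)
      have "r \<le> R" "\<bar>x i - z\<bar> \<le> R" if "i \<in> {M..N}" for i
        using elim that by (auto simp: R0_def)
      then have "r \<le> R" and "{i. i \<in> {M..N} \<and> i \<noteq> i0 \<and> \<bar>x i - z\<bar> \<le> R} = {i. i \<in> {M..N} \<and> i \<noteq> i0}"
        using i0 by auto
      then show ?case using truncated_sum[OF i0 closest z r \<open>r \<le> R\<close>] by simp
    qed
  qed
  ultimately show ?thesis by (auto dest: tendsto_upperbound)
qed

end

section \<open>The level points of the theorem\<close>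

lemma C11_imp_bounded_C11:
  assumes "C11 v"
  obtains L B V where "bounded_C11 v (deriv v) L B V"
proof -
  obtain B where B: "\<And>x. \<bar>v x\<bar> \<le> B" using assms by (auto simp: C11_def bounded_iff)
  obtain V where V: "\<And>x. \<bar>deriv v x\<bar> \<le> V" using assms by (auto simp: C11_def bounded_iff)
  obtain L where L: "L-lipschitz_on UNIV (deriv v)" using assms by (auto simp: C11_def)
  have "bounded_C11 v (deriv v) L B V"
  proof
    show "(v has_real_derivative deriv v x) (at x)" for x
      using assms by (simp add: C11_def DERIV_deriv_iff_real_differentiable)
    show "\<bar>deriv v x - deriv v y\<bar> \<le> L * \<bar>x - y\<bar>" for x y
      using lipschitz_onD[OF L, of x y] by (simp add: dist_real_def)
  qed (fact V B)+
  then show ?thesis by (rule that)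
qed

context bounded_C11
begin

lemma bdd_range: "bdd_above (range v)" "bdd_below (range v)"
proof -
  have "\<bar>v y\<bar> \<le> B" for y by (rule bound)
  then have upper: "v y \<le> B" and lower: "- B \<le> v y" for y by (simp_all add: abs_le_iff minus_le_iff)
  show "bdd_above (range v)" using upper by (rule bdd_aboveI2)
  show "bdd_below (range v)" using lower by (rule bdd_belowI2)
qed

text \<open>The level set is nonempty by the intermediate value theorem, closed by continuity, and bounded below by
  any point whose value is smaller, so it contains its infimum.\<close>

lemma level_attained:
  assumes mono: "mono v" and s: "(INF y. v y) < s" "s < (SUP y. v y)"
  shows "v (Inf {y. v y = s}) = s"
proof -
  obtain a b where a: "v a < s" and b: "s < v b"
    using s bdd_range by (auto simp: cINF_less_iff less_cSUP_iff)
  have "a \<le> b" using a b monoD[OF mono, of b a] by linarith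
  then obtain y where "v y = s"
    using IVT'[of v a s b] a b continuous by (auto simp: less_imp_le)
  have "{y. v y = s} = v -` {s}" by auto
  then have "closed {y. v y = s}" using continuous by (simp add: continuous_closed_vimage closed_vimage)
  moreover have "a \<le> y" if "v y = s" for y using that a monoD[OF mono, of y a] by linarith
  then have "bdd_below {y. v y = s}" by (intro bdd_belowI[of _ a]) simp
  ultimately have "Inf {y. v y = s} \<in> {y. v y = s}"
    using \<open>v y = s\<close> by (intro closed_contains_Inf) auto
  then show ?thesis by simp
qed

text \<open>The indices \<open>M_idx v e\<close> and \<open>N_idx v e\<close> are rounded from values at distance \<open>e\<close> inside the range of \<open>v\<close>,
  and rounding moves them by less than another \<open>e\<close>: so the levels are attained and miss at most \<open>2 * e\<close> at
  either end.\<close>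

lemma level_points_level_pt:
  assumes mono: "mono v" and e: "0 < e"
  shows "level_points v v' L B V e (M_idx v e) (N_idx v e) (level_pt v e)"
proof -
  have "(INF y. v y) + e \<le> M_idx v e * e"
    using le_of_int_ceiling unfolding M_idx_def pos_divide_le_eq[OF e, symmetric] .
  moreover have "e * M_idx v e < (INF y. v y) + 2 * e"
    using e ceiling_correct[of "((INF y. v y) + e) / e"] by (auto simp: M_idx_def field_simps)
  ultimately have M: "e * M_idx v e < (INF y. v y) + 2 * e" "(INF y. v y) + e \<le> e * M_idx v e"
    by (simp_all add: mult.commute)
  have "N_idx v e * e \<le> (SUP y. v y) - e"
    using of_int_floor_le unfolding N_idx_def pos_le_divide_eq[OF e, symmetric] .
  moreover have "(SUP y. v y) - 2 * e < e * N_idx v e"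
    using e floor_correct[of "((SUP y. v y) - e) / e"] by (auto simp: N_idx_def field_simps)
  ultimately have N: "(SUP y. v y) - 2 * e < e * N_idx v e" "e * N_idx v e \<le> (SUP y. v y) - e"
    by (simp_all add: mult.commute)
  show ?thesis
  proof (intro level_points.intro level_points_axioms.intro)
    show "bounded_C11 v v' L B V" by (rule bounded_C11_axioms)
    show "mono v" "0 < e" by fact+
    show "e * M_idx v e \<le> v y + 2 * e" for y
      using M(1) cINF_lower[OF bdd_range(2), of y] by simp
    show "v y - 2 * e \<le> e * N_idx v e" for y
      using N(1) cSUP_upper[OF _ bdd_range(1), of y] by simp
    show "v (level_pt v e i) = e * i" if "i \<in> {M_idx v e..N_idx v e}" for i
      unfolding level_pt_def
    proof (rule level_attained[OF mono])
      have "e * M_idx v e \<le> e * i" "e * i \<le> e * N_idx v e" using that e by simp_all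
      then show "(INF y. v y) < e * i" "e * i < (SUP y. v y)" using M N e by linarith+
    qed
  qed
qed

lemma I1_short_eq: "I1_short r v z = 1 / pi * (LINT t:{0<..r}|lborel. second_diff v z t / t\<^sup>2)"
proof -
  have "{..r} \<inter> {0<..} = {0<..r}" by auto
  then show ?thesis using pv_integral_eq[of "{..r}" z] by (simp add: I1_short_def)
qed

lemma I1_eq: "I1 v z = 1 / pi * (LINT t:{0<..}|lborel. second_diff v z t / t\<^sup>2)"
  using pv_integral_eq[of UNIV z] by (simp add: I1_def)

end

text \<open>A single bound on the total error is turned into two separate error terms by truncating the error at \<open>c\<close>.\<close>

lemma split_error:
  fixes X Y c w :: real
  assumes "\<bar>X - Y\<bar> \<le> c + w" "0 \<le> c" "0 \<le> w"
  obtains a b where "\<bar>a\<bar> \<le> c" "\<bar>b\<bar> \<le> w" "1 / pi * X = 1 / pi * Y + a + b"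
proof
  define d where "d = (X - Y) / pi"
  have "\<bar>d\<bar> \<le> \<bar>X - Y\<bar> / 1" unfolding d_def abs_divide using pi_ge_two by (intro divide_left_mono) auto
  then have "\<bar>d\<bar> \<le> c + w" using assms(1) by simp
  then show "\<bar>max (- c) (min c d)\<bar> \<le> c" "\<bar>d - max (- c) (min c d)\<bar> \<le> w"
    using assms(2,3) by (auto simp: max_def min_def)
  show "1 / pi * X = 1 / pi * Y + max (- c) (min c d) + (d - max (- c) (min c d))"
    by (simp add: d_def diff_divide_distrib)
qed

theorem proposition4p7:
  "\<exists>c :: real \<Rightarrow> real. (\<forall>K. 0 < c K) \<and>
    (\<forall>v :: real \<Rightarrow> real. C11 v \<and> mono v \<and> \<not> v constant_on UNIV \<longrightarrow>
      (\<exists>(C :: real) (\<omega> :: real \<Rightarrow> real). (\<omega> \<longlongrightarrow> 0) (at_right 0) \<and>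
        (\<forall>\<epsilon> \<rho> z \<gamma> i0.
           0 < \<epsilon> \<and> \<epsilon> < 1 \<and> c (C11_norm v) * \<epsilon> powr (1/2) \<le> \<rho> \<and>
           z \<in> {level_pt v \<epsilon> (M_idx v \<epsilon>) + \<rho> <..< level_pt v \<epsilon> (N_idx v \<epsilon>) - \<rho>} \<and>
           closest_idx v \<epsilon> z i0 \<and> z = level_pt v \<epsilon> i0 + \<epsilon> * \<gamma> \<longrightarrow>
           (\<exists>a b. \<bar>a\<bar> \<le> C * \<bar>\<gamma>\<bar> \<and> \<bar>b\<bar> \<le> \<omega> \<epsilon> \<and>
              1 / pi * (\<Sum>i | i \<in> {M_idx v \<epsilon>..N_idx v \<epsilon>} \<and> i \<noteq> i0 \<and> \<bar>level_pt v \<epsilon> i - z\<bar> \<le> \<rho>.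
                          \<epsilon> / (level_pt v \<epsilon> i - z))
              = I1_short \<rho> v z + a + 1 / pi * ((v (z + \<rho>) + v (z - \<rho>) - 2 * v z) / \<rho>) + b) \<and>
           (\<exists>a b. \<bar>a\<bar> \<le> C * \<bar>\<gamma>\<bar> \<and> \<bar>b\<bar> \<le> \<omega> \<epsilon> \<and>
              1 / pi * (\<Sum>i | i \<in> {M_idx v \<epsilon>..N_idx v \<epsilon>} \<and> i \<noteq> i0.
                          \<epsilon> / (level_pt v \<epsilon> i - z))
              = I1 v z + b + a))))"
proof (intro exI[of _ "\<lambda>_. 1"] conjI allI impI)
  fix v :: "real \<Rightarrow> real"
  assume v: "C11 v \<and> mono v \<and> \<not> v constant_on UNIV"
  then obtain L B V where "bounded_C11 v (deriv v) L B V" using C11_imp_bounded_C11 by blast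
  then interpret bounded_C11 v "deriv v" L B V .
  \<comment> \<open>the remainder is evaluated at the cutoff radius \<open>sqrt \<epsilon>\<close>, which \<open>\<rho>\<close> must not fall below\<close>
  define \<omega> where "\<omega> \<epsilon> = remainder (sqrt \<epsilon>)" for \<epsilon>
  have "continuous_on UNIV \<omega>" unfolding \<omega>_def remainder_def by (intro continuous_intros)
  then have "(\<omega> \<longlongrightarrow> \<omega> 0) (at 0)" by (simp add: continuous_on_def)
  then have \<omega>_0: "(\<omega> \<longlongrightarrow> 0) (at_right 0)"
    by (simp add: \<omega>_def remainder_def filterlim_at_split)
  show "\<exists>(C :: real) (\<omega> :: real \<Rightarrow> real). (\<omega> \<longlongrightarrow> 0) (at_right 0) \<and>
        (\<forall>\<epsilon> \<rho> z \<gamma> i0.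
           0 < \<epsilon> \<and> \<epsilon> < 1 \<and> 1 * \<epsilon> powr (1/2) \<le> \<rho> \<and>
           z \<in> {level_pt v \<epsilon> (M_idx v \<epsilon>) + \<rho> <..< level_pt v \<epsilon> (N_idx v \<epsilon>) - \<rho>} \<and>
           closest_idx v \<epsilon> z i0 \<and> z = level_pt v \<epsilon> i0 + \<epsilon> * \<gamma> \<longrightarrow>
           (\<exists>a b. \<bar>a\<bar> \<le> C * \<bar>\<gamma>\<bar> \<and> \<bar>b\<bar> \<le> \<omega> \<epsilon> \<and>
              1 / pi * (\<Sum>i | i \<in> {M_idx v \<epsilon>..N_idx v \<epsilon>} \<and> i \<noteq> i0 \<and> \<bar>level_pt v \<epsilon> i - z\<bar> \<le> \<rho>.
                          \<epsilon> / (level_pt v \<epsilon> i - z))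
              = I1_short \<rho> v z + a + 1 / pi * ((v (z + \<rho>) + v (z - \<rho>) - 2 * v z) / \<rho>) + b) \<and>
           (\<exists>a b. \<bar>a\<bar> \<le> C * \<bar>\<gamma>\<bar> \<and> \<bar>b\<bar> \<le> \<omega> \<epsilon> \<and>
              1 / pi * (\<Sum>i | i \<in> {M_idx v \<epsilon>..N_idx v \<epsilon>} \<and> i \<noteq> i0.
                          \<epsilon> / (level_pt v \<epsilon> i - z))
              = I1 v z + b + a))"
  proof (intro exI[of _ "8 * V\<^sup>2"] exI[of _ \<omega>] conjI[OF \<omega>_0] allI impI, elim conjE)
    fix \<epsilon> \<rho> z \<gamma> i0
    assume \<epsilon>: "0 < \<epsilon>" and \<rho>: "1 * \<epsilon> powr (1/2) \<le> \<rho>"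
      and closest: "closest_idx v \<epsilon> z i0" and z: "z = level_pt v \<epsilon> i0 + \<epsilon> * \<gamma>"
    interpret level_points v "deriv v" L B V \<epsilon> "M_idx v \<epsilon>" "N_idx v \<epsilon>" "level_pt v \<epsilon>"
      using level_points_level_pt v \<epsilon> by blast
    have r: "0 < sqrt \<epsilon>" "(sqrt \<epsilon>)\<^sup>2 = \<epsilon>" "sqrt \<epsilon> \<le> \<rho>"
      using \<epsilon> \<rho> by (simp_all add: powr_half_sqrt)
    have i0: "i0 \<in> {M_idx v \<epsilon>..N_idx v \<epsilon>}"
      and near: "\<And>i. i \<in> {M_idx v \<epsilon>..N_idx v \<epsilon>} \<Longrightarrow> \<bar>level_pt v \<epsilon> i0 - z\<bar> \<le> \<bar>level_pt v \<epsilon> i - z\<bar>"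
      using closest by (auto simp: closest_idx_def)
    have \<omega>_nonneg: "0 \<le> \<omega> \<epsilon>"
      using L_nonneg V_nonneg \<epsilon> by (simp add: \<omega>_def remainder_def)
    have C_nonneg: "0 \<le> 8 * V\<^sup>2 * \<bar>\<gamma>\<bar>" by simp
    show "(\<exists>a b. \<bar>a\<bar> \<le> 8 * V\<^sup>2 * \<bar>\<gamma>\<bar> \<and> \<bar>b\<bar> \<le> \<omega> \<epsilon> \<and>
        1 / pi * (\<Sum>i | i \<in> {M_idx v \<epsilon>..N_idx v \<epsilon>} \<and> i \<noteq> i0 \<and> \<bar>level_pt v \<epsilon> i - z\<bar> \<le> \<rho>.
                    \<epsilon> / (level_pt v \<epsilon> i - z))
        = I1_short \<rho> v z + a + 1 / pi * ((v (z + \<rho>) + v (z - \<rho>) - 2 * v z) / \<rho>) + b) \<and>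
      (\<exists>a b. \<bar>a\<bar> \<le> 8 * V\<^sup>2 * \<bar>\<gamma>\<bar> \<and> \<bar>b\<bar> \<le> \<omega> \<epsilon> \<and>
        1 / pi * (\<Sum>i | i \<in> {M_idx v \<epsilon>..N_idx v \<epsilon>} \<and> i \<noteq> i0. \<epsilon> / (level_pt v \<epsilon> i - z))
        = I1 v z + b + a)"
    proof (rule conjI)
      obtain a b where "\<bar>a\<bar> \<le> 8 * V\<^sup>2 * \<bar>\<gamma>\<bar>" "\<bar>b\<bar> \<le> \<omega> \<epsilon>"
        "1 / pi * (\<Sum>i | i \<in> {M_idx v \<epsilon>..N_idx v \<epsilon>} \<and> i \<noteq> i0 \<and> \<bar>level_pt v \<epsilon> i - z\<bar> \<le> \<rho>. \<epsilon> / (level_pt v \<epsilon> i - z))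
          = 1 / pi * ((LINT t:{0<..\<rho>}|lborel. second_diff v z t / t\<^sup>2) + second_diff v z \<rho> / \<rho>) + a + b"
        by (rule split_error[OF truncated_sum[OF i0 near z r, folded \<omega>_def] C_nonneg \<omega>_nonneg])
      then show "\<exists>a b. \<bar>a\<bar> \<le> 8 * V\<^sup>2 * \<bar>\<gamma>\<bar> \<and> \<bar>b\<bar> \<le> \<omega> \<epsilon> \<and>
        1 / pi * (\<Sum>i | i \<in> {M_idx v \<epsilon>..N_idx v \<epsilon>} \<and> i \<noteq> i0 \<and> \<bar>level_pt v \<epsilon> i - z\<bar> \<le> \<rho>. \<epsilon> / (level_pt v \<epsilon> i - z))
        = I1_short \<rho> v z + a + 1 / pi * ((v (z + \<rho>) + v (z - \<rho>) - 2 * v z) / \<rho>) + b"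
        unfolding I1_short_eq by (intro exI[of _ a] exI[of _ b] conjI) (simp_all only: distrib_left add_ac)
      obtain a b where "\<bar>a\<bar> \<le> 8 * V\<^sup>2 * \<bar>\<gamma>\<bar>" "\<bar>b\<bar> \<le> \<omega> \<epsilon>"
        "1 / pi * (\<Sum>i | i \<in> {M_idx v \<epsilon>..N_idx v \<epsilon>} \<and> i \<noteq> i0. \<epsilon> / (level_pt v \<epsilon> i - z))
          = 1 / pi * (LINT t:{0<..}|lborel. second_diff v z t / t\<^sup>2) + a + b"
        by (rule split_error[OF full_sum[OF i0 near z r(1,2), folded \<omega>_def] C_nonneg \<omega>_nonneg])
      then show "\<exists>a b. \<bar>a\<bar> \<le> 8 * V\<^sup>2 * \<bar>\<gamma>\<bar> \<and> \<bar>b\<bar> \<le> \<omega> \<epsilon> \<and>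
        1 / pi * (\<Sum>i | i \<in> {M_idx v \<epsilon>..N_idx v \<epsilon>} \<and> i \<noteq> i0. \<epsilon> / (level_pt v \<epsilon> i - z))
        = I1 v z + b + a"
        unfolding I1_eq by (intro exI[of _ a] exI[of _ b] conjI) (simp_all only: add_ac)
    qed
  qed
qed simp

end
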